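(* Let $\mathcal{H}$ be a separable quaternionic Hilbert space and let $J\in\mathcal{B}(\mathcal{H})$ be anti-selfadjoint and unitary. If $T$ is a compact operator on $\mathcal{H}$ such that $[T,J]=0$ and $p\in(0,+\infty)$, then $$T\in S_p(J)\iff |T|^p=(T^*T)^{\frac p2}\in S_1(J)\iff T^*T\in S_{\frac p2}(J).$$ Moreover $$\|T\|_p^p=\||T|\|_p^p=\||T|^p\|_1=\|T^*T\|_{\frac p2}^{\frac p2}.$$ As a consequence, $T\in S_p(J)\iff |T|\in S_p(J)$.
   Context: $\mathbb{H}$ denotes the quaternions. A quaternionic Hilbert space $\mathcal{H}$ is a right $\mathbb{H}$-vector space with a scalar product $\langle\cdot,\cdot\rangle:\mathcal{H}\times\mathcal{H}\to\mathbb{H}$ that is positive definite, right linear in the second argument, satisfies $\langle x,y\rangle=\overline{\langle y,x\rangle}$, and is complete for $\|x\|=\sqrt{\langle x,x\rangle}$. $\mathcal{B}(\mathcal{H})$ is the set of bounded right $\mathbb{H}$-linear operators, $\mathcal{B}_0(\mathcal{H})$ the set of compact ones. The adjoint is defined by $\langle T^*x,y\rangle=\langle x,Ty\rangle$; $J$ anti-selfadjoint and unitary means $J^*=-J$ and $J^*=J^{-1}$; $[T,J]=TJ-JT$. $T$ is positive if $\langle x,Tx\rangle\ge0$ for all $x$; positive operators have a unique positive square root, and $|T|=\sqrt{T^*T}$. For a positive compact operator $A$ there is an orthonormal basis $(e_n)$ of $\mathcal{H}$ with $Ax=\sum_n e_n\lambda_n\langle e_n,x\rangle$, $\lambda_n\ge0$;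 for $p>0$ one sets $A^px=\sum_n e_n\lambda_n^p\langle e_n,x\rangle$. For $T\in\mathcal{B}_0(\mathcal{H})$ the singular values $(\lambda_n(T))_{n\in\mathbb{N}}$ are the eigenvalues of $|T|$ (non-negative reals) in decreasing order, counted with multiplicity. For $p\in(0,+\infty)$, $S_p(J)=\{T\in\mathcal{B}_0(\mathcal{H}):[T,J]=0,\ (\lambda_n(T))_n\in\ell^p\}$ and $\|T\|_p=(\sum_n\lambda_n(T)^p)^{1/p}$ (with value $+\infty$ if the sum diverges). *)

theory Defs
  imports "HOL-Analysis.Analysis" "HOL-Library.Equipollence"
begin

section \<open>Quaternions\<close>

codatatype quat = Quat (qRe: real) (qIm1: real) (qIm2: real) (qIm3: real)

lemma quat_eqI: "qRe a = qRe b \<Longrightarrow> qIm1 a = qIm1 b \<Longrightarrow> qIm2 a = qIm2 b \<Longrightarrow> qIm3 a = qIm3 b \<Longrightarrow> a = b"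
  by (rule quat.expand) simp

lemma quat_eq_iff: "a = b \<longleftrightarrow> qRe a = qRe b \<and> qIm1 a = qIm1 b \<and> qIm2 a = qIm2 b \<and> qIm3 a = qIm3 b"
  by (auto intro: quat_eqI)

instantiation quat :: real_vector
begin

primcorec zero_quat where
  "qRe 0 = 0" | "qIm1 0 = 0" | "qIm2 0 = 0" | "qIm3 0 = 0"

primcorec plus_quat where
  "qRe (a + b) = qRe a + qRe b"
| "qIm1 (a + b) = qIm1 a + qIm1 b"
| "qIm2 (a + b) = qIm2 a + qIm2 b"
| "qIm3 (a + b) = qIm3 a + qIm3 b"

primcorec uminus_quat where
  "qRe (- a) = - qRe a" | "qIm1 (- a) = - qIm1 a" | "qIm2 (- a) = - qIm2 a" | "qIm3 (- a) = - qIm3 a"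

primcorec minus_quat where
  "qRe (a - b) = qRe a - qRe b"
| "qIm1 (a - b) = qIm1 a - qIm1 b"
| "qIm2 (a - b) = qIm2 a - qIm2 b"
| "qIm3 (a - b) = qIm3 a - qIm3 b"

primcorec scaleR_quat where
  "qRe (r *\<^sub>R a) = r * qRe a"
| "qIm1 (r *\<^sub>R a) = r * qIm1 a"
| "qIm2 (r *\<^sub>R a) = r * qIm2 a"
| "qIm3 (r *\<^sub>R a) = r * qIm3 a"

instance
  by standard (simp_all add: quat_eq_iff algebra_simps)

end

instantiation quat :: real_algebra_1
begin

primcorec one_quat where
  "qRe 1 = 1" | "qIm1 1 = 0" | "qIm2 1 = 0" | "qIm3 1 = 0"

primcorec times_quat where
  "qRe (a * b) = qRe a * qRe b - qIm1 a * qIm1 b - qIm2 a * qIm2 b - qIm3 a * qIm3 b"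
| "qIm1 (a * b) = qRe a * qIm1 b + qIm1 a * qRe b + qIm2 a * qIm3 b - qIm3 a * qIm2 b"
| "qIm2 (a * b) = qRe a * qIm2 b - qIm1 a * qIm3 b + qIm2 a * qRe b + qIm3 a * qIm1 b"
| "qIm3 (a * b) = qRe a * qIm3 b + qIm1 a * qIm2 b - qIm2 a * qIm1 b + qIm3 a * qRe b"

instance
  by standard (simp_all add: quat_eq_iff algebra_simps)

end

primcorec qcnj :: "quat \<Rightarrow> quat" where
  "qRe (qcnj a) = qRe a"
| "qIm1 (qcnj a) = - qIm1 a"
| "qIm2 (qcnj a) = - qIm2 a"
| "qIm3 (qcnj a) = - qIm3 a"

section \<open>Quaternionic Hilbert spaces\<close>

text \<open>
  The superclass \<^class>\<open>real_inner\<close> is the real structure obtained by restricting the scalars; its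
  scalar product is the real part of the quaternionic one. By conjugate symmetry \<open>qinner x x\<close> is
  real, so the axioms of \<^class>\<open>real_inner\<close> say that \<open>qinner\<close> is positive definite and that the
  norm of \<open>x\<close> is the square root of \<open>qinner x x\<close>.
\<close>

class quaternionic_hilbert = real_inner + complete_space +
  fixes qscale :: "'a \<Rightarrow> quat \<Rightarrow> 'a"  (infixl \<open>\<odot>\<close> 75)
    and qinner :: "'a \<Rightarrow> 'a \<Rightarrow> quat"
  assumes qscale_add_left: "(x + y) \<odot> a = x \<odot> a + y \<odot> a"
    and qscale_add_right: "x \<odot> (a + b) = x \<odot> a + x \<odot> b"
    and qscale_qscale: "(x \<odot> a) \<odot> b = x \<odot> (a * b)"
    and qscale_one: "x \<odot> 1 = x"
    and qscale_of_real: "x \<odot> of_real r = r *\<^sub>R x"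
    and qinner_add_right: "qinner x (y + z) = qinner x y + qinner x z"
    and qinner_qscale_right: "qinner x (y \<odot> a) = qinner x y * a"
    and qinner_cnj: "qinner x y = qcnj (qinner y x)"
    and inner_eq_qRe_qinner: "inner x y = qRe (qinner x y)"

text \<open>Bases are unordered sets: \<^const>\<open>has_sum\<close> is unconditional convergence, which for orthogonal
  series agrees with ordinary convergence, and finite and infinite dimension need no distinction.\<close>

definition orthonormal_basis_of :: "'a::quaternionic_hilbert set \<Rightarrow> 'a set \<Rightarrow> bool" where
  "orthonormal_basis_of V E \<longleftrightarrow>
     E \<subseteq> V \<and>
     (\<forall>e\<in>E. \<forall>f\<in>E. qinner e f = (if e = f then 1 else 0)) \<and>
     (\<forall>x\<in>V. ((\<lambda>e. e \<odot> qinner e x) has_sum x) E)"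

section \<open>Operators\<close>

definition bounded_ops :: "('a::quaternionic_hilbert \<Rightarrow> 'a) set" where
  "bounded_ops = {T. bounded_linear T \<and> (\<forall>x a. T (x \<odot> a) = T x \<odot> a)}"

definition compact_ops :: "('a::quaternionic_hilbert \<Rightarrow> 'a) set" where
  "compact_ops = {T \<in> bounded_ops. \<forall>B. bounded B \<longrightarrow> compact (closure (T ` B))}"

definition adj_op :: "('a::quaternionic_hilbert \<Rightarrow> 'a) \<Rightarrow> 'a \<Rightarrow> 'a" where
  "adj_op T = (THE S. \<forall>x y. qinner (S x) y = qinner x (T y))"

definition anti_selfadjoint :: "('a::quaternionic_hilbert \<Rightarrow> 'a) \<Rightarrow> bool" where
  "anti_selfadjoint T \<longleftrightarrow> adj_op T = (\<lambda>x. - T x)"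

definition unitary_op :: "('a::quaternionic_hilbert \<Rightarrow> 'a) \<Rightarrow> bool" where
  "unitary_op T \<longleftrightarrow> bij T \<and> adj_op T = inv T"

definition commutator :: "('a::quaternionic_hilbert \<Rightarrow> 'a) \<Rightarrow> ('a \<Rightarrow> 'a) \<Rightarrow> 'a \<Rightarrow> 'a" where
  "commutator T J = (\<lambda>x. T (J x) - J (T x))"

definition positive_op :: "('a::quaternionic_hilbert \<Rightarrow> 'a) \<Rightarrow> bool" where
  "positive_op T \<longleftrightarrow> (\<forall>x. \<exists>r\<ge>0. qinner x (T x) = of_real r)"

definition sqrt_op :: "('a::quaternionic_hilbert \<Rightarrow> 'a) \<Rightarrow> 'a \<Rightarrow> 'a" where
  "sqrt_op A = (THE S. S \<in> bounded_ops \<and> positive_op S \<and> S \<circ> S = A)"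

definition abs_op :: "('a::quaternionic_hilbert \<Rightarrow> 'a) \<Rightarrow> 'a \<Rightarrow> 'a" where
  "abs_op T = sqrt_op (adj_op T \<circ> T)"

text \<open>Meaningful for positive compact \<open>A\<close> and \<open>p > 0\<close> only; the result does not depend on the
  diagonalising basis. Note that \<^prop>\<open>(0::real) powr p = 0\<close>.\<close>

definition pow_op :: "('a::quaternionic_hilbert \<Rightarrow> 'a) \<Rightarrow> real \<Rightarrow> 'a \<Rightarrow> 'a" where
  "pow_op A p = (THE B. \<exists>E lam.
     orthonormal_basis_of UNIV E \<and> (\<forall>e\<in>E. 0 \<le> lam e) \<and>
     (\<forall>x. ((\<lambda>e. e \<odot> of_real (lam e) \<odot> qinner e x) has_sum A x) E) \<and>
     (\<forall>x. ((\<lambda>e. e \<odot> of_real (lam e powr p) \<odot> qinner e x) has_sum B x) E))"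

section \<open>Singular values and Schatten classes\<close>

definition eigenspace :: "('a::quaternionic_hilbert \<Rightarrow> 'a) \<Rightarrow> real \<Rightarrow> 'a set" where
  "eigenspace A r = {x. A x = x \<odot> of_real r}"

text \<open>
  Each positive eigenvalue of \<^term>\<open>abs_op T\<close> is listed as often as the quaternionic dimension of its
  eigenspace, i.e. the cardinality of an orthonormal basis of it. Only positive values are
  constrained: the sequence is filled up with zeros if there are finitely many of them (also in
  finite dimension), and the eigenvalue zero is never reached if there are infinitely many.
\<close>

definition singular_value :: "('a::quaternionic_hilbert \<Rightarrow> 'a) \<Rightarrow> nat \<Rightarrow> real" where
  "singular_value T = (THE s. decseq s \<and> (\<forall>n. 0 \<le> s n) \<and>
     (\<forall>r>0. \<exists>E. orthonormal_basis_of (eigenspace (abs_op T) r) E \<and> {n. s n = r} \<approx> E))"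

definition schatten_class :: "('a::quaternionic_hilbert \<Rightarrow> 'a) \<Rightarrow> real \<Rightarrow> ('a \<Rightarrow> 'a) set" where
  "schatten_class J p =
     {T \<in> compact_ops. commutator T J = (\<lambda>_. 0) \<and> summable (\<lambda>n. singular_value T n powr p)}"

text \<open>Intended for \<open>r > 0\<close>, where the power of \<open>\<infinity>\<close> is \<open>\<infinity>\<close>.\<close>

definition ennreal_powr :: "ennreal \<Rightarrow> real \<Rightarrow> ennreal" where
  "ennreal_powr x r = (if x = \<infinity> then \<infinity> else ennreal (enn2real x powr r))"

definition schatten_norm :: "real \<Rightarrow> ('a::quaternionic_hilbert \<Rightarrow> 'a) \<Rightarrow> ennreal" where
  "schatten_norm p T = ennreal_powr (\<Sum>n. ennreal (singular_value T n powr p)) (1 / p)"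

end

theory Submission
  imports Defs
begin

text \<open>
  A maximal orthonormal set of eigenvectors of \<open>T* T\<close> is a basis, because a positive compact operator
  that leaves a nonzero closed subspace invariant attains its largest quadratic form value there at
  an eigenvector. So \<open>T* T\<close> is diagonal in an orthonormal basis \<open>E\<close>, with eigenvalues \<open>lam e\<close>. The
  positive square root and the powers are unique because every operator of either kind acts on an
  eigenvector as the corresponding scalar; hence all operators involved are diagonal in the same basis
  \<open>E\<close>, with powers of \<open>a e = sqrt (lam e)\<close> as eigenvalues, they inherit compactness from the finiteness
  of \<open>{e. r \<le> a e}\<close> for \<open>r > 0\<close>, and they commute with \<open>J\<close>, which preserves the eigenspaces of \<open>T* T\<close>.
  The singular values of \<open>T\<close> are determined by \<open>r \<le> singular_value T n \<longleftrightarrow> n < card {e. r \<le> a e}\<close>, so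
  raising the eigenvalues to a power raises the singular values to the same power.
\<close>

subsection \<open>Quaternions and quaternionic scalar products\<close>

text \<open>\<open>adj_op\<close>, \<open>sqrt_op\<close>, \<open>pow_op\<close> and
  \<open>singular_value\<close> are definite descriptions: they say nothing until one object with
  the required property is known to exist and no other. Most of the work is these existence and
  uniqueness statements; the identities then follow by comparing eigenvalues in one basis. Scalars
  do not commute and \<open>quat\<close> carries no topology, so limits and sums are taken in the
  real inner product. A quaternionic value is recovered from the real numbers
  \<open>inner (x \<odot> a) y\<close> for all \<open>a\<close>. Singular values are specified by
  the multiplicity of each positive level, which does not directly give the value at an index
  \<open>n\<close>. Counting eigenvalues above a threshold does, and thresholds pass through a power
  function by monotonicity, so no ordering of the basis is chosen. The same counts cover finite
  rank, where zeros fill the sequence, and infinite rank, where zero is never listed.\<close>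

lemma quat_of_real_sel [simp]:
  "qRe (of_real r) = r" "qIm1 (of_real r) = 0" "qIm2 (of_real r) = 0" "qIm3 (of_real r) = 0"
  by (simp_all add: of_real_def)

lemma qcnj_mult: "qcnj (a * b) = qcnj b * qcnj a"
  by (simp add: quat_eq_iff algebra_simps)

lemma qcnj_add: "qcnj (a + b) = qcnj a + qcnj b"
  and qcnj_qcnj [simp]: "qcnj (qcnj a) = a"
  and qcnj_0 [simp]: "qcnj 0 = 0"
  and qcnj_of_real [simp]: "qcnj (of_real r) = of_real r"
  by (simp_all add: quat_eq_iff)

text \<open>The squared modulus, kept squared because coefficients enter only through sums of
  squares.\<close>

definition qnorm2 :: "quat \<Rightarrow> real" where
  "qnorm2 a = (qRe a)\<^sup>2 + (qIm1 a)\<^sup>2 + (qIm2 a)\<^sup>2 + (qIm3 a)\<^sup>2"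

lemma qnorm2_nonneg [simp]: "0 \<le> qnorm2 a"
  by (simp add: qnorm2_def)

lemma qnorm2_eq_0_iff [simp]: "qnorm2 a = 0 \<longleftrightarrow> a = 0"
  by (simp add: qnorm2_def quat_eq_iff add_nonneg_eq_0_iff conj_assoc)

lemma qnorm2_qcnj [simp]: "qnorm2 (qcnj a) = qnorm2 a"
  by (simp add: qnorm2_def)

lemma qcnj_mult_self: "qcnj a * a = of_real (qnorm2 a)"
  by (simp add: quat_eq_iff qnorm2_def power2_eq_square algebra_simps)

lemma qnorm2_of_real_mult: "qnorm2 (of_real r * a) = r\<^sup>2 * qnorm2 a"
  by (simp add: qnorm2_def power_mult_distrib algebra_simps)

lemma of_real_quat_commute: "of_real r * a = a * (of_real r :: quat)"
  by (simp add: quat_eq_iff algebra_simps)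

context
  fixes x y z :: "'a::quaternionic_hilbert"
begin

lemma qnorm2_qinner_commute: "qnorm2 (qinner x y) = qnorm2 (qinner y x)"
  by (metis qinner_cnj qnorm2_qcnj)

lemma qinner_qscale_left: "qinner (x \<odot> a) y = qcnj a * qinner x y"
  by (metis qinner_cnj qinner_qscale_right qcnj_mult qcnj_qcnj)

lemma qinner_add_left: "qinner (x + y) z = qinner x z + qinner y z"
  by (metis qinner_cnj qinner_add_right qcnj_add)

lemma qscale_scaleR_left: "(r *\<^sub>R x) \<odot> a = r *\<^sub>R (x \<odot> a)"
  by (metis qscale_of_real qscale_qscale of_real_quat_commute)

lemma qscale_of_real_qscale: "x \<odot> of_real r \<odot> a = r *\<^sub>R (x \<odot> a)"
  by (simp add: qscale_of_real qscale_scaleR_left)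

lemma qinner_scaleR_right: "qinner x (r *\<^sub>R y) = of_real r * qinner x y"
  by (metis qscale_of_real qinner_qscale_right of_real_quat_commute)

lemma qinner_scaleR_left: "qinner (r *\<^sub>R x) y = of_real r * qinner x y"
  by (metis qscale_of_real qinner_qscale_left qcnj_of_real)

lemma qinner_minus_right: "qinner x (- y) = - qinner x y"
  using qinner_scaleR_right[of "- 1"] by simp

lemma qinner_minus_left: "qinner (- x) y = - qinner x y"
  using qinner_scaleR_left[of "- 1"] by simp

lemma qinner_zero_right [simp]: "qinner x 0 = 0"
  using qinner_scaleR_right[of 0] by simp

lemma qinner_self: "qinner x x = of_real ((norm x)\<^sup>2)"
proof -
  have "qinner x x = qcnj (qinner x x)" by (rule qinner_cnj)
  then show ?thesis
    by (simp add: quat_eq_iff power2_norm_eq_inner inner_eq_qRe_qinner)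
qed

end

lemma inner_qscale_left: "inner (x \<odot> a) y = qRe (qcnj a * qinner x (y :: 'a::quaternionic_hilbert))"
  by (simp only: inner_eq_qRe_qinner qinner_qscale_left)

lemma norm_qscale_sq:
  fixes x :: "'a::quaternionic_hilbert"
  shows "(norm (x \<odot> a))\<^sup>2 = qnorm2 a * (norm x)\<^sup>2"
proof -
  have "(norm (x \<odot> a))\<^sup>2 = qRe (qcnj a * (qinner x x * a))"
    by (simp only: power2_norm_eq_inner inner_eq_qRe_qinner qinner_qscale_left qinner_qscale_right
        mult.assoc)
  also have "qinner x x = of_real ((norm x)\<^sup>2)" by (rule qinner_self)
  also have "qcnj a * (of_real ((norm x)\<^sup>2) * a) = of_real ((norm x)\<^sup>2) * (qcnj a * a)"
    by (metis mult.assoc of_real_quat_commute)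
  finally show ?thesis by (simp add: qcnj_mult_self del: of_real_power)
qed

lemma norm_qscale: "norm (x \<odot> a) = norm (x :: 'a::quaternionic_hilbert) * sqrt (qnorm2 a)"
  by (rule power2_eq_imp_eq) (simp_all add: norm_qscale_sq power_mult_distrib)

lemma qinner_diff_right:
  "qinner x (y - z) = qinner x y - qinner x (z :: 'a::quaternionic_hilbert)"
  using qinner_add_right[of x y "- z"] by (simp add: qinner_minus_right)

lemma qinner_diff_left:
  "qinner (x - y) z = qinner x z - qinner y (z :: 'a::quaternionic_hilbert)"
  using qinner_add_left[of x "- y" z] by (simp add: qinner_minus_left)

lemma qscale_zero_right [simp]: "(x :: 'a::quaternionic_hilbert) \<odot> 0 = 0"
  using qscale_of_real[of x 0] by simp

text \<open>Testing with \<open>a = q\<close>, the difference of the two products, produces the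
  squared modulus of \<open>q\<close>. This carries identities of the real inner product over to
  \<open>qinner\<close>.\<close>

lemma qinner_eqI:
  fixes x x' y y' :: "'a::quaternionic_hilbert"
  assumes "\<And>a. inner (x \<odot> a) y = inner (x' \<odot> a) y'"
  shows "qinner x y = qinner x' y'"
proof -
  define q where "q = qinner x y - qinner x' y'"
  have "qRe (qcnj q * q) = inner (x \<odot> q) y - inner (x' \<odot> q) y'"
    unfolding inner_qscale_left q_def right_diff_distrib minus_quat.sel ..
  then have "qRe (qcnj q * q) = 0" by (simp add: assms)
  then have "q = 0" by (simp add: qcnj_mult_self)
  then show ?thesis by (simp add: q_def)
qed

lemma qinner_eq_imp_eq:
  fixes x y :: "'a::quaternionic_hilbert"
  assumes "\<And>z. qinner x z = qinner y z"
  shows "x = y"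
proof -
  have "qinner (x - y) (x - y) = 0" by (simp add: qinner_diff_left assms)
  then show ?thesis by (simp add: qinner_self del: of_real_power)
qed

subsection \<open>Orthogonal series\<close>

text \<open>By Pythagoras the partial sums over nested finite sets differ in square by a difference
  of sums of \<open>(norm (f i))\<^sup>2\<close>, and these converge. So the net of partial sums is
  Cauchy.\<close>

lemma orthogonal_summable_on:
  fixes f :: "'i \<Rightarrow> 'a::{real_inner, complete_space}"
  assumes orth: "pairwise (\<lambda>i j. orthogonal (f i) (f j)) E"
    and bd: "\<And>F. finite F \<Longrightarrow> F \<subseteq> E \<Longrightarrow> (\<Sum>i\<in>F. (norm (f i))\<^sup>2) \<le> C"
  shows "f summable_on E"
proof -
  let ?g = "\<lambda>i. (norm (f i))\<^sup>2"
  have "?g summable_on E"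
    by (rule nonneg_bdd_above_summable_on) (auto intro!: bdd_aboveI2[where M = C] bd)
  then obtain L where lim: "(sum ?g \<longlongrightarrow> L) (finite_subsets_at_top E)"
    unfolding has_sum_def summable_on_def by blast
  have "\<exists>P. eventually P (finite_subsets_at_top E) \<and>
              (\<forall>F F'. P F \<and> P F' \<longrightarrow> dist (sum f F) (sum f F') < e)" if "e > 0" for e
  proof -
    \<comment> \<open>Two sums of squares within \<open>d\<close> of \<open>L\<close> differ by less
      than \<open>2 * d = (e / 2)\<^sup>2\<close>, so each side of the later triangle inequality is
      below \<open>e / 2\<close>.\<close>
    define d P where "d = e\<^sup>2 / 8" and "P F \<longleftrightarrow> finite F \<and> F \<subseteq> E \<and> dist (sum ?g F) L < d" for F
    have "d > 0" using that by (simp add: d_def)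
    have ev_P: "eventually P (finite_subsets_at_top E)"
      using lim
      by (auto simp add: P_def[abs_def] \<open>0 < d\<close> eventually_conj_iff
          eventually_finite_subsets_at_top_weakI tendsto_iff)
    then have "\<exists>F0. finite F0 \<and> F0 \<subseteq> E \<and> (\<forall>F. finite F \<and> F0 \<subseteq> F \<and> F \<subseteq> E \<longrightarrow> P F)"
      unfolding eventually_finite_subsets_at_top .
    then obtain F0 where F0: "finite F0" "F0 \<subseteq> E"
      and P_sup: "\<And>F. finite F \<Longrightarrow> F0 \<subseteq> F \<Longrightarrow> F \<subseteq> E \<Longrightarrow> P F"
      by metis
    have "dist (sum f F1) (sum f F2) < e" if "P F1" "P F2" for F1 F2
    proof -
      \<comment> \<open>Pythagoras compares nested sets only, so \<open>F1\<close> and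
        \<open>F2\<close> are compared through a common superset; including \<open>F0\<close>
        ensures \<open>P F\<close>.\<close>
      define F where "F = F0 \<union> F1 \<union> F2"
      have F: "finite F" "F \<subseteq> E" "P F"
        using F0 that P_sup[of F] by (auto simp: F_def P_def)
      have near: "dist (sum f F) (sum f F') < e / 2" if "F' \<subseteq> F" "P F'" for F'
      proof -
        have "(dist (sum f F) (sum f F'))\<^sup>2 = (norm (sum f (F - F')))\<^sup>2"
          unfolding dist_norm using F that by (subst sum_diff) auto
        also have "\<dots> = sum ?g (F - F')"
          using F by (intro norm_sum_Pythagorean) (auto intro: pairwise_subset[OF orth])
        also have "\<dots> = sum ?g F - sum ?g F'"
          using F that by (intro sum_diff) auto
        also have "\<dots> < 2 * d"
          using F(3) that(2) unfolding P_def dist_real_def by linarith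
        also have "\<dots> = (e / 2)\<^sup>2" by (simp add: d_def power2_eq_square)
        finally show ?thesis by (rule power_less_imp_less_base) (use \<open>e > 0\<close> in simp)
      qed
      have "dist (sum f F1) (sum f F2) \<le> dist (sum f F) (sum f F1) + dist (sum f F) (sum f F2)"
        by (rule dist_triangle3)
      also have "\<dots> < e / 2 + e / 2"
        using that by (intro add_strict_mono near) (auto simp: F_def)
      finally show ?thesis by simp
    qed
    then show ?thesis using ev_P by blast
  qed
  then have "cauchy_filter (filtermap (sum f) (finite_subsets_at_top E))"
    by (simp add: cauchy_filter_metric_filtermap)
  moreover have "complete (UNIV :: 'a set)"
    by (meson Cauchy_convergent UNIV_I complete_def convergent_def)
  ultimately obtain L' where "(sum f \<longlongrightarrow> L') (finite_subsets_at_top E)"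
    using complete_uniform[where S = UNIV] by (force simp add: filterlim_def)
  then show ?thesis
    using summable_on_def has_sum_def by blast
qed

lemma has_sum_norm_le:
  fixes f :: "'i \<Rightarrow> 'a::real_normed_vector"
  assumes "(f has_sum s) E" and "\<And>F. finite F \<Longrightarrow> F \<subseteq> E \<Longrightarrow> norm (sum f F) \<le> C"
  shows "norm s \<le> C"
proof (rule Lim_norm_ubound)
  show "(sum f \<longlongrightarrow> s) (finite_subsets_at_top E)" using assms(1) by (simp add: has_sum_def)
  show "\<forall>\<^sub>F F in finite_subsets_at_top E. norm (sum f F) \<le> C"
    by (rule eventually_finite_subsets_at_top_weakI) (use assms(2) in auto)
qed simp

section \<open>Orthonormal families: Bessel's inequality, coefficients and multipliers\<close>

definition orthonormal :: "'a::quaternionic_hilbert set \<Rightarrow> bool" where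
  "orthonormal E \<longleftrightarrow> (\<forall>e\<in>E. \<forall>f\<in>E. qinner e f = (if e = f then 1 else 0))"

lemma orthonormal_subset: "orthonormal E \<Longrightarrow> F \<subseteq> E \<Longrightarrow> orthonormal F"
  unfolding orthonormal_def by blast

lemma orthonormal_norm:
  assumes "orthonormal E" "e \<in> E"
  shows "norm e = 1"
proof -
  have "of_real ((norm e)\<^sup>2) = (of_real 1 :: quat)"
    using assms qinner_self[of e] by (simp add: orthonormal_def del: of_real_power)
  then have "(norm e)\<^sup>2 = 1" unfolding of_real_eq_iff .
  then show ?thesis by (metis abs_norm_cancel abs_one real_sqrt_abs real_sqrt_one)
qed

lemma orthonormal_norm_qscale: "orthonormal E \<Longrightarrow> e \<in> E \<Longrightarrow> (norm (e \<odot> a))\<^sup>2 = qnorm2 a"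
  by (simp add: norm_qscale_sq orthonormal_norm)

lemma orthonormal_pairwise:
  assumes "orthonormal E"
  shows "pairwise (\<lambda>e f. orthogonal (e \<odot> c e) (f \<odot> c f)) E"
  using assms unfolding pairwise_def orthogonal_def orthonormal_def
  by (simp add: inner_qscale_left qinner_qscale_right)

lemma orthonormal_norm_sum:
  assumes "orthonormal E" "finite F" "F \<subseteq> E"
  shows "(norm (\<Sum>e\<in>F. e \<odot> c e))\<^sup>2 = (\<Sum>e\<in>F. qnorm2 (c e))"
proof -
  have "orthonormal F" using assms orthonormal_subset by blast
  then show ?thesis
    using norm_sum_Pythagorean[OF assms(2) orthonormal_pairwise, of c]
    by (simp add: orthonormal_norm_qscale)
qed

lemma orthonormal_summable_on:
  assumes "orthonormal E" and "\<And>F. finite F \<Longrightarrow> F \<subseteq> E \<Longrightarrow> (\<Sum>e\<in>F. qnorm2 (c e)) \<le> C"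
  shows "(\<lambda>e. e \<odot> c e) summable_on E"
proof (rule orthogonal_summable_on[OF orthonormal_pairwise[OF assms(1)]])
  fix F assume F: "finite F" "F \<subseteq> E"
  then have "(\<Sum>e\<in>F. (norm (e \<odot> c e))\<^sup>2) = (\<Sum>e\<in>F. qnorm2 (c e))"
    using orthonormal_norm_qscale[OF assms(1)] by (intro sum.cong) auto
  then show "(\<Sum>e\<in>F. (norm (e \<odot> c e))\<^sup>2) \<le> C" using assms(2) F by simp
qed

text \<open>The partial expansion \<open>?v\<close> satisfies
  \<open>(norm ?v)\<^sup>2 = inner ?v x\<close>; Cauchy-Schwarz and cancellation of
  \<open>norm ?v\<close> bound it by \<open>norm x\<close>.\<close>

lemma bessel:
  assumes "orthonormal E" "finite F" "F \<subseteq> E"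
  shows "(\<Sum>e\<in>F. qnorm2 (qinner e x)) \<le> (norm x)\<^sup>2"
proof -
  let ?v = "\<Sum>e\<in>F. e \<odot> qinner e x"
  have v: "(norm ?v)\<^sup>2 = (\<Sum>e\<in>F. qnorm2 (qinner e x))"
    by (rule orthonormal_norm_sum[OF assms])
  also have "\<dots> = inner ?v x"
    by (simp add: inner_sum_left inner_qscale_left qcnj_mult_self)
  also have "\<dots> \<le> norm ?v * norm x" by (rule norm_cauchy_schwarz)
  finally have "norm ?v \<le> norm x"
    by (cases "norm ?v = 0") (auto simp: power2_eq_square)
  then show ?thesis unfolding v[symmetric] by (rule power_mono) simp
qed

text \<open>Only the term at \<open>f\<close> survives. Passing to the limit uses continuity of the
  real functionals \<open>inner (f \<odot> a)\<close>, one for each \<open>a\<close>.\<close>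

lemma qinner_has_sum_coeff:
  assumes "orthonormal E" "((\<lambda>e. e \<odot> c e) has_sum y) E" "f \<in> E"
  shows "qinner f y = c f"
proof -
  have "qinner f y = qinner f (f \<odot> c f)"
  proof (rule qinner_eqI)
    fix a
    have "((\<lambda>e. inner (f \<odot> a) (e \<odot> c e)) has_sum inner (f \<odot> a) y) E"
      by (rule has_sum_bounded_linear[OF bounded_linear_inner_right assms(2)])
    moreover have "((\<lambda>e. inner (f \<odot> a) (e \<odot> c e)) has_sum inner (f \<odot> a) (f \<odot> c f)) E"
      by (rule has_sum_finite_neutralI[where B = "{f}"])
        (use assms in \<open>auto simp: orthonormal_def inner_qscale_left qinner_qscale_right\<close>)
    ultimately show "inner (f \<odot> a) y = inner (f \<odot> a) (f \<odot> c f)" by (rule has_sum_unique)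
  qed
  also have "\<dots> = c f" using assms by (simp add: orthonormal_def qinner_qscale_right)
  finally show ?thesis .
qed

text \<open>The one estimate behind summability and boundedness of diagonal operators, and, with a
  small \<open>M\<close>, behind the tail bound that gives compactness.\<close>

lemma multiplier_norm_sum_le:
  assumes E: "orthonormal E" and F: "finite F" "F \<subseteq> E"
    and M: "0 \<le> M" "\<And>e. e \<in> F \<Longrightarrow> \<bar>m e\<bar> \<le> M"
  shows "norm (\<Sum>e\<in>F. e \<odot> of_real (m e) \<odot> qinner e x) \<le> M * norm x"
proof -
  have "(norm (\<Sum>e\<in>F. e \<odot> of_real (m e) \<odot> qinner e x))\<^sup>2
      = (\<Sum>e\<in>F. (m e)\<^sup>2 * qnorm2 (qinner e x))"
    using orthonormal_norm_sum[OF E F, of "\<lambda>e. of_real (m e) * qinner e x"]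
    by (simp only: qscale_qscale qnorm2_of_real_mult)
  also have "\<dots> \<le> (\<Sum>e\<in>F. M\<^sup>2 * qnorm2 (qinner e x))"
    by (intro sum_mono mult_right_mono) (use M in \<open>auto simp: abs_le_square_iff[symmetric]\<close>)
  also have "\<dots> \<le> M\<^sup>2 * (norm x)\<^sup>2"
    unfolding sum_distrib_left[symmetric] by (intro mult_left_mono bessel[OF E F]) simp
  finally show ?thesis
    using M(1) by (auto intro: power2_le_imp_le simp: power_mult_distrib)
qed

lemma multiplier_summable_on:
  assumes E: "orthonormal E" and M: "0 \<le> M" "\<And>e. e \<in> E \<Longrightarrow> \<bar>m e\<bar> \<le> M"
  shows "(\<lambda>e. e \<odot> of_real (m e) \<odot> qinner e x) summable_on E"
proof -
  have "(\<lambda>e. e \<odot> (of_real (m e) * qinner e x)) summable_on E"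
  proof (rule orthonormal_summable_on[OF E, where C = "(M * norm x)\<^sup>2"])
    fix F assume F: "finite F" "F \<subseteq> E"
    have "norm (\<Sum>e\<in>F. e \<odot> of_real (m e) \<odot> qinner e x) \<le> M * norm x"
      using F M by (intro multiplier_norm_sum_le[OF E]) auto
    then have "(norm (\<Sum>e\<in>F. e \<odot> (of_real (m e) * qinner e x)))\<^sup>2 \<le> (M * norm x)\<^sup>2"
      unfolding qscale_qscale by (rule power_mono) simp
    then show "(\<Sum>e\<in>F. qnorm2 (of_real (m e) * qinner e x)) \<le> (M * norm x)\<^sup>2"
      by (simp only: orthonormal_norm_sum[OF E F])
  qed
  then show ?thesis by (simp only: qscale_qscale)
qed

section \<open>Orthonormal bases: existence and cardinality\<close>

lemma orthonormal_basis_of_iff: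
  "orthonormal_basis_of V E \<longleftrightarrow>
    E \<subseteq> V \<and> orthonormal E \<and> (\<forall>x\<in>V. ((\<lambda>e. e \<odot> qinner e x) has_sum x) E)"
  by (simp add: orthonormal_basis_of_def orthonormal_def)

lemma orthonormal_basis_eqI:
  assumes "orthonormal_basis_of UNIV E" and "\<And>e. e \<in> E \<Longrightarrow> qinner e x = qinner e y"
  shows "x = y"
proof -
  have "((\<lambda>e. e \<odot> qinner e x) has_sum x) E" "((\<lambda>e. e \<odot> qinner e y) has_sum y) E"
    using assms(1) by (auto simp: orthonormal_basis_of_iff)
  moreover have "((\<lambda>e. e \<odot> qinner e x) has_sum x) E \<longleftrightarrow> ((\<lambda>e. e \<odot> qinner e y) has_sum x) E"
    by (rule has_sum_cong) (simp add: assms(2))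
  ultimately show ?thesis using has_sum_unique by blast
qed

text \<open>Orthonormality involves two vectors at a time, and any two vectors from a chain lie in a
  common member.\<close>

lemma orthonormal_UN_chain:
  assumes "subset.chain {E. orthonormal E \<and> E \<subseteq> P} C"
  shows "\<Union>C \<in> {E. orthonormal E \<and> E \<subseteq> P}"
proof -
  have "qinner e f = (if e = f then 1 else 0)" if ef: "e \<in> \<Union>C" "f \<in> \<Union>C" for e f
  proof -
    obtain X Y where XY: "X \<in> C" "e \<in> X" "Y \<in> C" "f \<in> Y" using ef by blast
    then have "X \<subseteq> Y \<or> Y \<subseteq> X" using assms unfolding subset_chain_def by blast
    then obtain Z where "Z \<in> C" "e \<in> Z" "f \<in> Z" using XY by blast
    then show ?thesis using assms unfolding subset_chain_def orthonormal_def by blast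
  qed
  then show ?thesis using assms by (auto simp: orthonormal_def subset_chain_def)
qed

text \<open>Zorn's lemma inside \<open>P\<close>, meant for \<open>P\<close> a set of eigenvectors.
  The extension hypothesis asks for some new unit vector of \<open>P\<close> orthogonal to
  \<open>E\<close>, not one in the direction of \<open>x\<close>. By maximality only zero is
  orthogonal to \<open>E\<close>, and \<open>x\<close> minus the sum of its expansion is orthogonal
  to \<open>E\<close>.\<close>

lemma exists_orthonormal_basis_within:
  fixes P :: "'a::quaternionic_hilbert set"
  assumes ext: "\<And>E x. orthonormal E \<Longrightarrow> E \<subseteq> P \<Longrightarrow> x \<noteq> 0 \<Longrightarrow> \<forall>e\<in>E. qinner e x = 0 \<Longrightarrow>
      \<exists>f\<in>P. norm f = 1 \<and> (\<forall>e\<in>E. qinner e f = 0)"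
  obtains E where "E \<subseteq> P" "orthonormal_basis_of UNIV E"
proof -
  obtain E where E: "orthonormal E" "E \<subseteq> P"
    and max: "\<And>X. orthonormal X \<Longrightarrow> X \<subseteq> P \<Longrightarrow> E \<subseteq> X \<Longrightarrow> X = E"
    using subset_Zorn'[of "{E. orthonormal E \<and> E \<subseteq> P}", OF orthonormal_UN_chain] by auto
  have complete: "x = 0" if x: "\<forall>e\<in>E. qinner e x = 0" for x
  proof (rule ccontr)
    assume "x \<noteq> 0"
    then obtain f where f: "f \<in> P" "norm f = 1" "\<forall>e\<in>E. qinner e f = 0"
      using ext[OF E _ x] by blast
    have "qinner f f = 1" using f(2) by (simp add: qinner_self del: of_real_power)
    moreover have "qinner f e = 0" if "e \<in> E" for e
      using f(3) that by (metis qinner_cnj qcnj_0)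
    ultimately have "orthonormal (insert f E)"
      using E(1) f(3) by (auto simp: orthonormal_def)
    then have "f \<in> E" using max[of "insert f E"] E f by blast
    with f(3) \<open>qinner f f = 1\<close> show False by auto
  qed
  have "((\<lambda>e. e \<odot> qinner e x) has_sum x) E" for x
  proof -
    have "(\<lambda>e. e \<odot> qinner e x) summable_on E"
      by (rule orthonormal_summable_on[OF E(1) bessel[OF E(1)]])
    then obtain y where y: "((\<lambda>e. e \<odot> qinner e x) has_sum y) E"
      by (auto simp: summable_on_def)
    have "x - y = 0"
      by (rule complete) (simp add: qinner_diff_right qinner_has_sum_coeff[OF E(1) y])
    with y show ?thesis by simp
  qed
  with E have "orthonormal_basis_of UNIV E" by (auto simp: orthonormal_basis_of_iff)
  with E(2) that show thesis by blast
qed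

lemma exists_orthonormal_basis:
  obtains E :: "'a::quaternionic_hilbert set" where "orthonormal_basis_of UNIV E"
proof (rule exists_orthonormal_basis_within[of "UNIV :: 'a set"])
  fix E and x :: 'a
  assume "x \<noteq> 0" "\<forall>e\<in>E. qinner e x = 0"
  then show "\<exists>f\<in>UNIV. norm f = 1 \<and> (\<forall>e\<in>E. qinner e f = 0)"
    by (intro bexI[of _ "x /\<^sub>R norm x"]) (auto simp: qinner_scaleR_right)
qed

text \<open>Double counting of \<open>qnorm2 (qinner e f)\<close>: summing over \<open>E\<close>
  gives exactly 1 for each \<open>f\<close>, summing over a finite part of \<open>F\<close> gives at
  most 1 for each \<open>e\<close>. A uniform bound on finite parts also makes \<open>F\<close>
  finite.\<close>

lemma orthonormal_card_le:
  assumes "orthonormal_basis_of V E" "finite E" "orthonormal F" "F \<subseteq> V"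
  shows "finite F \<and> card F \<le> card E"
proof -
  have E: "orthonormal E" and sum: "\<And>x. x \<in> V \<Longrightarrow> (\<Sum>e\<in>E. e \<odot> qinner e x) = x"
    using assms(1,2) has_sum_unique[OF has_sum_finite[OF assms(2)]]
    by (auto simp: orthonormal_basis_of_iff)
  have bound: "card G \<le> card E" if G: "finite G" "G \<subseteq> F" for G
  proof -
    have parseval: "(\<Sum>e\<in>E. qnorm2 (qinner e f)) = 1" if "f \<in> G" for f
    proof -
      have "f \<in> V" "norm f = 1"
        using that G assms(3,4) orthonormal_norm by blast+
      then show ?thesis
        using orthonormal_norm_sum[OF E assms(2) subset_refl, of "\<lambda>e. qinner e f"] sum[of f]
        by simp
    qed
    have "real (card G) = (\<Sum>f\<in>G. \<Sum>e\<in>E. qnorm2 (qinner e f))"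
      by (simp add: parseval)
    also have "\<dots> = (\<Sum>e\<in>E. \<Sum>f\<in>G. qnorm2 (qinner e f))" by (rule sum.swap)
    also have "\<dots> = (\<Sum>e\<in>E. \<Sum>f\<in>G. qnorm2 (qinner f e))"
        by (simp only: qnorm2_qinner_commute)
    also have "\<dots> \<le> (\<Sum>e\<in>E. (norm e)\<^sup>2)"
      by (intro sum_mono bessel[OF assms(3)] G)
    also have "\<dots> = real (card E)" by (simp add: orthonormal_norm[OF E])
    finally show ?thesis by simp
  qed
  then have "finite F" by (meson finite_if_finite_subsets_card_bdd)
  then show ?thesis using bound by blast
qed

text \<open>Makes the multiplicity well defined: \<open>singular_value\<close> only provides some
  basis of each eigenspace.\<close>

lemma orthonormal_basis_card_eq:
  assumes "orthonormal_basis_of V E" "orthonormal_basis_of V F" "finite E"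
  shows "finite F" "card F = card E"
proof -
  show "finite F"
    using orthonormal_card_le[OF assms(1,3)] assms(2) by (auto simp: orthonormal_basis_of_iff)
  have "orthonormal F" "F \<subseteq> V" "orthonormal E" "E \<subseteq> V"
    using assms(1,2) by (auto simp: orthonormal_basis_of_iff)
  then show "card F = card E"
    using orthonormal_card_le[OF assms(1,3)] orthonormal_card_le[OF assms(2) \<open>finite F\<close>]
    by (meson antisym)
qed

subsection \<open>Adjoints and positive operators\<close>

lemma bounded_opsD:
  assumes "T \<in> bounded_ops"
  shows "bounded_linear T" "T (x \<odot> a) = T x \<odot> a"
  using assms by (auto simp: bounded_ops_def)

lemma compact_opsD:
  assumes "T \<in> compact_ops"
  shows "T \<in> bounded_ops" "bounded B \<Longrightarrow> compact (closure (T ` B))"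
  using assms by (auto simp: compact_ops_def)

lemma qinner_eq_0_iff_inner:
  "qinner x y = 0 \<longleftrightarrow> (\<forall>a. inner (x \<odot> a) (y :: 'a::quaternionic_hilbert) = 0)"
  using qinner_eqI[of x y 0 0] by (auto simp: inner_qscale_left)

text \<open>An adjoint must have the coefficients \<open>qinner (T e) x\<close>, so
  \<open>S x\<close> is defined by that series. Its partial sums \<open>?v\<close> satisfy
  \<open>(norm ?v)\<^sup>2 = inner (T ?v) x\<close>, which bounds them by \<open>K * norm x\<close>
  as in Bessel's inequality.\<close>

lemma adjoint_exists:
  fixes T :: "'a::quaternionic_hilbert \<Rightarrow> 'a"
  assumes T: "T \<in> bounded_ops"
  shows "\<exists>S. \<forall>x y. qinner (S x) y = qinner x (T y)"
proof -
  note lin = bounded_opsD(1)[OF T] and scale = bounded_opsD(2)[OF T]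
  obtain E :: "'a set" where E: "orthonormal E" "\<And>x. ((\<lambda>e. e \<odot> qinner e x) has_sum x) E"
    using exists_orthonormal_basis by (auto simp: orthonormal_basis_of_iff)
  obtain K where K: "0 \<le> K" "\<And>x. norm (T x) \<le> norm x * K"
    using bounded_linear.nonneg_bounded[OF lin] by blast
  define S where "S x = (\<Sum>\<^sub>\<infinity>e\<in>E. e \<odot> qinner (T e) x)" for x
  have S: "((\<lambda>e. e \<odot> qinner (T e) x) has_sum S x) E" for x
  proof -
    have "(\<lambda>e. e \<odot> qinner (T e) x) summable_on E"
    proof (rule orthonormal_summable_on[OF E(1), where C = "(K * norm x)\<^sup>2"])
      fix F assume F: "finite F" "F \<subseteq> E"
      let ?v = "\<Sum>e\<in>F. e \<odot> qinner (T e) x"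
      have v: "(norm ?v)\<^sup>2 = (\<Sum>e\<in>F. qnorm2 (qinner (T e) x))"
        by (rule orthonormal_norm_sum[OF E(1) F])
      also have "\<dots> = inner (T ?v) x"
        by (simp add: linear_sum[OF bounded_linear.linear[OF lin]] scale inner_sum_left
            inner_qscale_left qcnj_mult_self)
      also have "\<dots> \<le> norm (T ?v) * norm x" by (rule norm_cauchy_schwarz)
      also have "\<dots> \<le> (norm ?v * K) * norm x" by (intro mult_right_mono K) simp
      finally have "norm ?v \<le> K * norm x"
        using K(1) by (cases "norm ?v = 0") (auto simp: power2_eq_square algebra_simps)
      then show "(\<Sum>e\<in>F. qnorm2 (qinner (T e) x)) \<le> (K * norm x)\<^sup>2"
        unfolding v[symmetric] by (rule power_mono) simp
    qed
    then show ?thesis by (simp add: S_def)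
  qed
  have real: "inner y (S x) = inner (T y) x" for x y
  proof -
    have "((\<lambda>e. inner y (e \<odot> qinner (T e) x)) has_sum inner y (S x)) E"
      by (rule has_sum_bounded_linear[OF bounded_linear_inner_right S])
    moreover have "inner y (e \<odot> qinner (T e) x) = inner (T (e \<odot> qinner e y)) x" for e
      by (simp only: scale inner_qscale_left)
        (simp only: inner_eq_qRe_qinner qinner_qscale_right qinner_cnj[of y e])
    moreover have "((\<lambda>e. inner (T (e \<odot> qinner e y)) x) has_sum inner (T y) x) E"
      by (intro has_sum_bounded_linear[OF bounded_linear_inner_left]
          has_sum_bounded_linear[OF lin] E(2))
    ultimately show ?thesis using has_sum_unique by fastforce
  qed
  have "qinner y (S x) = qinner (T y) x" for x y
    by (rule qinner_eqI) (simp add: real scale)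
  then show ?thesis by (metis qinner_cnj)
qed

lemma adj_op_eqI:
  assumes "\<And>x y. qinner (S x) y = qinner x (T y)"
  shows "adj_op T = S"
  unfolding adj_op_def
proof (rule the_equality)
  show "\<forall>x y. qinner (S x) y = qinner x (T y)" by (simp add: assms)
  fix S' assume "\<forall>x y. qinner (S' x) y = qinner x (T y)"
  then have "qinner (S' x) y = qinner (S x) y" for x y by (simp only: assms)
  then show "S' = S" by (intro ext qinner_eq_imp_eq)
qed

lemma qinner_adj_op_left:
  assumes "T \<in> bounded_ops"
  shows "qinner (adj_op T x) y = qinner x (T y)"
proof -
  obtain S where "\<And>x y. qinner (S x) y = qinner x (T y)"
    using adjoint_exists[OF assms] by blast
  then show ?thesis using adj_op_eqI[of S T] by simp
qed

lemma qinner_adj_op_right: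
  assumes "T \<in> bounded_ops"
  shows "qinner x (adj_op T y) = qinner (T x) y"
  by (metis assms qinner_adj_op_left qinner_cnj)

lemma adj_op_bounded_ops:
  assumes T: "T \<in> bounded_ops"
  shows "adj_op T \<in> bounded_ops"
proof -
  note left = qinner_adj_op_left[OF T]
  obtain K where K: "0 \<le> K" "\<And>x. norm (T x) \<le> norm x * K"
    using bounded_linear.nonneg_bounded[OF bounded_opsD(1)[OF T]] by blast
  have bound: "norm (adj_op T x) \<le> norm x * K" for x
  proof -
    have "(norm (adj_op T x))\<^sup>2 = inner x (T (adj_op T x))"
      by (simp only: power2_norm_eq_inner inner_eq_qRe_qinner left)
    also have "\<dots> \<le> norm x * norm (T (adj_op T x))" by (rule norm_cauchy_schwarz)
    also have "\<dots> \<le> norm x * (norm (adj_op T x) * K)" by (intro mult_left_mono K) simp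
    finally show ?thesis
      using K(1) by (cases "norm (adj_op T x) = 0") (auto simp: power2_eq_square algebra_simps)
  qed
  have "bounded_linear (adj_op T)"
  proof (rule bounded_linear_intro[where K = K])
    show "adj_op T (x + y) = adj_op T x + adj_op T y" for x y
      by (rule qinner_eq_imp_eq) (simp add: left qinner_add_left)
    show "adj_op T (r *\<^sub>R x) = r *\<^sub>R adj_op T x" for r x
      by (rule qinner_eq_imp_eq) (simp add: left qinner_scaleR_left)
  qed (rule bound)
  moreover have "adj_op T (x \<odot> a) = adj_op T x \<odot> a" for x a
    by (rule qinner_eq_imp_eq) (simp add: left qinner_qscale_left)
  ultimately show ?thesis by (simp add: bounded_ops_def)
qed

lemma positive_op_adj_op_comp:
  assumes "T \<in> bounded_ops"
  shows "positive_op (adj_op T \<circ> T)"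
  unfolding positive_op_def
  by (auto simp: qinner_adj_op_right[OF assms] qinner_self simp del: of_real_power
      intro: exI[where x = "(norm _)\<^sup>2"])

lemma comp_bounded_ops:
  assumes "S \<in> bounded_ops" "T \<in> bounded_ops"
  shows "S \<circ> T \<in> bounded_ops"
  using bounded_linear_compose[OF bounded_opsD(1)[OF assms(1)] bounded_opsD(1)[OF assms(2)]]
    bounded_opsD(2)[OF assms(1)] bounded_opsD(2)[OF assms(2)]
  by (simp add: bounded_ops_def comp_def)

lemma comp_compact_ops:
  assumes "S \<in> bounded_ops" "T \<in> compact_ops"
  shows "S \<circ> T \<in> compact_ops"
proof -
  have T: "T \<in> bounded_ops" using assms(2) by (simp add: compact_ops_def)
  have "S \<circ> T \<in> bounded_ops" by (rule comp_bounded_ops[OF assms(1) T])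
  moreover have "compact (closure ((S \<circ> T) ` B))" if "bounded B" for B
  proof -
    have "compact (closure (T ` B))" using assms(2) that by (simp add: compact_ops_def)
    then have *: "compact (S ` closure (T ` B))"
      by (intro compact_continuous_image bounded_linear.continuous_on[OF bounded_opsD(1)[OF assms(1)]]
          continuous_on_id)
    have "(S \<circ> T) ` B \<subseteq> S ` closure (T ` B)"
      using closure_subset[of "T ` B"] by (auto simp: image_comp[symmetric])
    then have "closure ((S \<circ> T) ` B) \<subseteq> S ` closure (T ` B)"
      by (rule closure_minimal) (rule compact_imp_closed[OF *])
    then show ?thesis
      by (metis * closed_closure compact_Int_closed inf.absorb_iff2)
  qed
  ultimately show ?thesis by (simp add: compact_ops_def)
qed

text \<open>Since \<open>qinner x (S x)\<close> is real for every vector, expanding it at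
  \<open>x + y\<close> kills the imaginary parts of the defect \<open>b x y\<close>. The real part
  needs quaternionic linearity.\<close>

lemma positive_op_symmetric:
  assumes S: "S \<in> bounded_ops" and pos: "positive_op S"
  shows "qinner (S x) y = qinner x (S y)"
proof -
  define b where "b x y = qinner x (S y) - qinner (S x) y" for x y
  note add = linear_add[OF bounded_linear.linear[OF bounded_opsD(1)[OF S]]]
  have im: "qIm1 (b x y) = 0 \<and> qIm2 (b x y) = 0 \<and> qIm3 (b x y) = 0" for x y
  proof -
    obtain r s t where "qinner x (S x) = of_real r" "qinner y (S y) = of_real s"
      "qinner (x + y) (S (x + y)) = of_real t"
      using pos unfolding positive_op_def by blast
    then have "of_real t = of_real r + of_real s + (qinner x (S y) + qinner y (S x))"
      by (simp add: add qinner_add_left qinner_add_right algebra_simps)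
    then have "qIm1 (qinner x (S y)) + qIm1 (qinner y (S x)) = 0"
      "qIm2 (qinner x (S y)) + qIm2 (qinner y (S x)) = 0"
      "qIm3 (qinner x (S y)) + qIm3 (qinner y (S x)) = 0"
      by (simp_all add: quat_eq_iff)
    then show ?thesis
      unfolding b_def qinner_cnj[of "S x" y] by simp
  qed
  \<comment> \<open>Multiplication by \<open>i\<close> moves the real part of \<open>b x y\<close>
    into the first imaginary part of \<open>b x (y \<odot> i)\<close>, already known to
    vanish.\<close>
  define i where "i = Quat 0 1 0 0"
  have "b x (y \<odot> i) = b x y * i"
    by (simp add: b_def bounded_opsD(2)[OF S] qinner_qscale_right left_diff_distrib)
  then have "qIm1 (b x y * i) = 0" using im[of x "y \<odot> i"] by simp
  then have "qRe (b x y) = 0" by (simp add: i_def)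
  with im[of x y] have "b x y = 0" by (simp add: quat_eq_iff)
  then show ?thesis by (simp add: b_def)
qed

subsection \<open>The spectral theorem for positive compact operators\<close>

text \<open>With \<open>m\<close> the supremum of the quadratic form on the unit sphere of
  \<open>V\<close>, a maximising sequence is asymptotically an eigenvector:
  \<open>(norm (A x - m *\<^sub>R x))\<^sup>2\<close> is at most
  \<open>m * (m - inner x (A x))\<close> for unit \<open>x\<close>. Compactness then gives a limit.
  The eigenvalue is real, so the real structure suffices.\<close>

lemma exists_unit_eigenvector:
  fixes A :: "'a::real_inner \<Rightarrow> 'a"
  assumes lin: "bounded_linear A"
    and sym: "\<And>x y. inner (A x) y = inner x (A y)"
    and pos: "\<And>x. 0 \<le> inner x (A x)"
    and cpt: "compact (closure (A ` sphere 0 1))"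
    and V: "subspace V" "closed V" "\<And>x. x \<in> V \<Longrightarrow> A x \<in> V"
    and v: "v \<in> V" "v \<noteq> 0"
  shows "\<exists>e\<in>V. norm e = 1 \<and> (\<exists>r\<ge>0. A e = r *\<^sub>R e)"
proof -
  interpret A: bounded_linear A by fact
  define u where "u = v /\<^sub>R norm v"
  have u: "u \<in> V" "norm u = 1" using v V(1) by (auto simp: u_def subspace_scale)
  define Q where "Q = (\<lambda>x. inner x (A x)) ` (V \<inter> sphere 0 1)"
  define m where "m = Sup Q"
  obtain K where K: "\<And>x. norm (A x) \<le> norm x * K" using A.bounded by blast
  have bdd: "bdd_above Q"
    unfolding Q_def
  proof (rule bdd_aboveI2)
    fix x assume "x \<in> V \<inter> sphere 0 1"
    then show "inner x (A x) \<le> K"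
      using norm_cauchy_schwarz[of x "A x"] K[of x] by simp
  qed
  have "inner u (A u) \<in> Q" using u by (auto simp: Q_def)
  then have ne: "Q \<noteq> {}" and m0: "0 \<le> m"
    using cSup_upper[OF _ bdd] pos[of u] by (auto simp: m_def intro: order_trans)
  have le_m: "inner x (A x) \<le> m * (norm x)\<^sup>2" if "x \<in> V" for x
  proof (cases "x = 0")
    case False
    let ?y = "x /\<^sub>R norm x"
    have "inner ?y (A ?y) \<in> Q"
      unfolding Q_def by (rule imageI) (use that False V(1) in \<open>simp add: subspace_scale\<close>)
    then have "inner ?y (A ?y) \<le> m" unfolding m_def by (rule cSup_upper[OF _ bdd])
    then show ?thesis using False
      by (simp add: A.scaleR power2_eq_square field_simps)
  qed (simp add: A.zero)
  \<comment> \<open>Positivity at \<open>x - A x / c\<close>; a substitute for Cauchy--Schwarz for the form \<open>inner x (A y)\<close>.\<close>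
  have norm_sq_le: "(norm (A x))\<^sup>2 \<le> c * inner x (A x)" if "x \<in> V" "m \<le> c" "0 < c" for x c
  proof -
    let ?z = "x - A x /\<^sub>R c"
    have sq: "(norm (A x))\<^sup>2 = inner x (A (A x))"
      by (simp add: power2_norm_eq_inner sym)
    have "0 \<le> inner ?z (A ?z)" by (rule pos)
    also have "\<dots> = inner x (A x) - 2 / c * (norm (A x))\<^sup>2 + inner (A x) (A (A x)) / c\<^sup>2"
      unfolding sq using sym[of x "A x"] that(3)
      by (simp add: A.diff A.scaleR inner_diff_left inner_diff_right field_simps power2_eq_square)
    also have "\<dots> \<le> inner x (A x) - 2 / c * (norm (A x))\<^sup>2 + c * (norm (A x))\<^sup>2 / c\<^sup>2"
    proof -
      have "inner (A x) (A (A x)) \<le> m * (norm (A x))\<^sup>2" by (intro le_m V that)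
      also have "\<dots> \<le> c * (norm (A x))\<^sup>2" by (intro mult_right_mono that) simp
      finally show ?thesis by (simp add: divide_right_mono)
    qed
    also have "\<dots> = inner x (A x) - (norm (A x))\<^sup>2 / c"
      using that(3) by (simp add: field_simps power2_eq_square)
    finally show ?thesis using that(3) by (simp add: field_simps)
  qed
  show ?thesis
  proof (cases "m = 0")
    \<comment> \<open>Here the vector cannot be recovered by dividing by \<open>m\<close>. Instead
      \<open>A\<close> vanishes on \<open>u\<close>, by the norm bound with \<open>c = 1\<close>;
      this is why that bound admits \<open>c\<close> larger than \<open>m\<close>.\<close>
    case True
    then have "(norm (A u))\<^sup>2 \<le> 1 * inner u (A u)" "inner u (A u) \<le> 0"
      using norm_sq_le[OF u(1), of 1] le_m[OF u(1)] by auto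
    then have "(norm (A u))\<^sup>2 \<le> 0" by linarith
    then have "A u = 0 *\<^sub>R u" by simp
    then show ?thesis using u by blast
  next
    case False
    with m0 have m: "0 < m" by simp
    have "\<exists>x. x \<in> V \<and> norm x = 1 \<and> m - inverse (real (Suc n)) < inner x (A x)" for n
    proof -
      have "m - inverse (real (Suc n)) < Sup Q" by (simp add: m_def)
      then show ?thesis unfolding less_cSup_iff[OF ne bdd] by (auto simp: Q_def)
    qed
    then obtain x where x: "\<And>n. x n \<in> V" "\<And>n. norm (x n) = 1"
      "\<And>n. m - inverse (real (Suc n)) < inner (x n) (A (x n))"
      by metis
    have "(\<lambda>n. (norm (A (x n) - m *\<^sub>R x n))\<^sup>2) \<longlonglongrightarrow> 0"
    proof (rule tendsto_sandwich[OF _ _ tendsto_const])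
      show "\<forall>\<^sub>F n in sequentially. (norm (A (x n) - m *\<^sub>R x n))\<^sup>2 \<le> m * inverse (real (Suc n))"
      proof (rule always_eventually, rule allI)
        fix n
        have "(norm (A (x n) - m *\<^sub>R x n))\<^sup>2
            = (norm (A (x n)))\<^sup>2 - 2 * m * inner (x n) (A (x n)) + m\<^sup>2 * (norm (x n))\<^sup>2"
          unfolding power2_norm_eq_inner
          by (simp add: inner_diff_left inner_diff_right inner_commute power2_eq_square algebra_simps)
        also have "\<dots> \<le> m * inner (x n) (A (x n)) - 2 * m * inner (x n) (A (x n)) + m\<^sup>2"
          using norm_sq_le[OF x(1) order_refl m, of n] by (simp add: x(2))
        also have "\<dots> = m * (m - inner (x n) (A (x n)))"
          by (simp add: power2_eq_square algebra_simps)
        also have "\<dots> \<le> m * inverse (real (Suc n))"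
          using x(3)[of n] m by (intro mult_left_mono) auto
        finally show "(norm (A (x n) - m *\<^sub>R x n))\<^sup>2 \<le> m * inverse (real (Suc n))" .
      qed
      show "(\<lambda>n. m * inverse (real (Suc n))) \<longlonglongrightarrow> 0"
        using tendsto_mult[OF tendsto_const LIMSEQ_inverse_real_of_nat, of m] by simp
    qed simp
    then have "(\<lambda>n. norm (A (x n) - m *\<^sub>R x n)) \<longlonglongrightarrow> 0"
      using tendsto_real_sqrt by fastforce
    then have diff: "(\<lambda>n. A (x n) - m *\<^sub>R x n) \<longlonglongrightarrow> 0" by (rule tendsto_norm_zero_cancel)
    have "\<forall>n. A (x n) \<in> closure (A ` sphere 0 1)"
      using x(2) closure_subset[of "A ` sphere 0 1"] by auto
    then obtain l r where r: "strict_mono r" "((\<lambda>n. A (x n)) \<circ> r) \<longlonglongrightarrow> l"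
      using cpt unfolding compact_def by metis
    \<comment> \<open>Compactness makes only the images \<open>A (x (r n))\<close> converge; as
      \<open>A (x n) - m *\<^sub>R x n\<close> tends to zero, the vectors themselves converge after
      division by \<open>m\<close>.\<close>
    have "(\<lambda>n. m *\<^sub>R x (r n)) \<longlonglongrightarrow> l"
      using tendsto_diff[OF r(2) LIMSEQ_subseq_LIMSEQ[OF diff r(1)]] by (simp add: comp_def)
    then have "(\<lambda>n. (1 / m) *\<^sub>R (m *\<^sub>R x (r n))) \<longlonglongrightarrow> (1 / m) *\<^sub>R l"
      by (intro tendsto_scaleR tendsto_const)
    then have lim: "(\<lambda>n. x (r n)) \<longlonglongrightarrow> (1 / m) *\<^sub>R l" (is "_ \<longlonglongrightarrow> ?e") using m by simp
    have "?e \<in> V" using closed_sequentially[OF V(2) _ lim] x(1) by blast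
    moreover have "norm ?e = 1"
      using tendsto_norm[OF lim] unfolding x(2) by (rule LIMSEQ_unique[OF _ tendsto_const])
    moreover have "A ?e = m *\<^sub>R ?e"
      using LIMSEQ_unique[OF A.tendsto[OF lim] r(2)[unfolded comp_def]] m by simp
    ultimately show ?thesis using m0 by blast
  qed
qed

text \<open>Matches the condition on \<open>A\<close> inside \<open>pow_op\<close>. Boundedness is
  left out: it is equivalent to a bound on \<open>lam\<close> and is derived in both
  directions.\<close>

definition diagonalises :: "'a::quaternionic_hilbert set \<Rightarrow> ('a \<Rightarrow> real) \<Rightarrow> ('a \<Rightarrow> 'a) \<Rightarrow> bool" where
  "diagonalises E lam A \<longleftrightarrow> orthonormal_basis_of UNIV E \<and> (\<forall>e\<in>E. 0 \<le> lam e) \<and>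
     (\<forall>x. ((\<lambda>e. e \<odot> of_real (lam e) \<odot> qinner e x) has_sum A x) E)"

lemma diagonalisesI:
  assumes E: "orthonormal_basis_of UNIV E" and lam: "\<And>e. e \<in> E \<Longrightarrow> 0 \<le> lam e"
    and A: "A \<in> bounded_ops" and eig: "\<And>e. e \<in> E \<Longrightarrow> A e = lam e *\<^sub>R e"
  shows "diagonalises E lam A"
proof -
  have "((\<lambda>e. e \<odot> of_real (lam e) \<odot> qinner e x) has_sum A x) E" for x
  proof -
    have "((\<lambda>e. A (e \<odot> qinner e x)) has_sum A x) E"
      using E by (intro has_sum_bounded_linear[OF bounded_opsD(1)[OF A]])
        (auto simp: orthonormal_basis_of_iff)
    moreover have "((\<lambda>e. A (e \<odot> qinner e x)) has_sum A x) E
        \<longleftrightarrow> ((\<lambda>e. e \<odot> of_real (lam e) \<odot> qinner e x) has_sum A x) E"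
      by (rule has_sum_cong) (simp add: bounded_opsD(2)[OF A] eig qscale_of_real)
    ultimately show ?thesis by blast
  qed
  then show ?thesis using E lam by (simp add: diagonalises_def)
qed

lemma positive_compact_diagonalises:
  fixes A :: "'a::quaternionic_hilbert \<Rightarrow> 'a"
  assumes A: "A \<in> compact_ops" and pos: "positive_op A"
  obtains E lam where "diagonalises E lam A"
proof -
  have bd: "A \<in> bounded_ops" using A by (simp add: compact_ops_def)
  note sym = positive_op_symmetric[OF bd pos]
  define P where "P = {x. \<exists>r\<ge>0. A x = r *\<^sub>R x}"
  obtain E where E: "E \<subseteq> P" "orthonormal_basis_of UNIV E"
  proof (rule exists_orthonormal_basis_within[of P])
    fix E and x :: 'a
    assume E: "orthonormal E" "E \<subseteq> P" and x: "x \<noteq> 0" "\<forall>e\<in>E. qinner e x = 0"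
    define V where "V = {x. \<forall>e\<in>E. qinner e x = 0}"
    have "\<exists>f\<in>V. norm f = 1 \<and> (\<exists>r\<ge>0. A f = r *\<^sub>R f)"
    proof (rule exists_unit_eigenvector[OF bounded_opsD(1)[OF bd]])
      show "inner (A x) y = inner x (A y)" for x y by (simp add: inner_eq_qRe_qinner sym)
      show "0 \<le> inner x (A x)" for x
        using pos unfolding positive_op_def inner_eq_qRe_qinner by (metis quat_of_real_sel(1))
      show "compact (closure (A ` sphere 0 1))"
        by (rule compact_opsD(2)[OF A bounded_subset[OF bounded_cball sphere_cball]])
      show "subspace V"
        by (auto simp: subspace_def V_def qinner_add_right qinner_scaleR_right)
      \<comment> \<open>Closedness is read off from real equations, since continuity is available
        for \<open>inner\<close> but not for \<open>qinner\<close>.\<close>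
      have "V = (\<Inter>e\<in>E. \<Inter>a. {x. inner (e \<odot> a) x = 0})"
        by (auto simp: V_def qinner_eq_0_iff_inner)
      moreover have "closed {x. inner (e \<odot> a) x = 0}" for e a
        by (intro closed_Collect_eq continuous_intros)
      ultimately show "closed V" by (auto intro!: closed_INT)
      show "A y \<in> V" if "y \<in> V" for y
      proof -
        have "qinner e (A y) = 0" if e: "e \<in> E" for e
        proof -
          obtain r where "A e = r *\<^sub>R e" using E(2) e by (auto simp: P_def)
          then have "qinner e (A y) = of_real r * qinner e y"
            by (simp add: sym[symmetric] qinner_scaleR_left)
          then show ?thesis using \<open>y \<in> V\<close> e by (simp add: V_def)
        qed
        then show ?thesis by (simp add: V_def)
      qed
      show "x \<in> V" "x \<noteq> 0" using x by (auto simp: V_def)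
    qed
    then show "\<exists>f\<in>P. norm f = 1 \<and> (\<forall>e\<in>E. qinner e f = 0)" by (auto simp: V_def P_def)
  qed
  then have "\<forall>e\<in>E. \<exists>r\<ge>0. A e = r *\<^sub>R e" by (auto simp: P_def)
  then obtain lam where "\<And>e. e \<in> E \<Longrightarrow> 0 \<le> lam e \<and> A e = lam e *\<^sub>R e" by metis
  then have "diagonalises E lam A" using E(2) bd by (intro diagonalisesI) auto
  then show thesis by (rule that)
qed

subsection \<open>Functional calculus for diagonalised operators\<close>

lemma diagonalisesD:
  assumes "diagonalises E lam A"
  shows "orthonormal_basis_of UNIV E" "orthonormal E" "\<And>e. e \<in> E \<Longrightarrow> 0 \<le> lam e"
    "((\<lambda>e. e \<odot> of_real (lam e) \<odot> qinner e x) has_sum A x) E"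
  using assms by (simp_all add: diagonalises_def orthonormal_basis_of_iff)

lemma diagonalises_coeff:
  assumes "diagonalises E lam A" "e \<in> E"
  shows "qinner e (A x) = of_real (lam e) * qinner e x"
  using diagonalisesD(4)[OF assms(1), of x] unfolding qscale_qscale
  by (rule qinner_has_sum_coeff[OF diagonalisesD(2)[OF assms(1)] _ assms(2)])

lemma diagonalises_eigenvector:
  assumes A: "diagonalises E lam A" and "e \<in> E"
  shows "A e = lam e *\<^sub>R e"
proof (rule orthonormal_basis_eqI[OF diagonalisesD(1)[OF A]])
  fix f assume "f \<in> E"
  then show "qinner f (A e) = qinner f (lam e *\<^sub>R e)"
    using diagonalisesD(2)[OF A] assms(2)
    by (simp add: diagonalises_coeff[OF A] qinner_scaleR_right orthonormal_def)
qed

lemma diagonalises_unique: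
  assumes "diagonalises E lam A" "diagonalises E lam B"
  shows "A = B"
  by (rule ext) (rule has_sum_unique[OF diagonalisesD(4)[OF assms(1)] diagonalisesD(4)[OF assms(2)]])

lemma diagonalises_cong:
  assumes "diagonalises E lam A" "\<And>e. e \<in> E \<Longrightarrow> mu e = lam e"
  shows "diagonalises E mu A"
proof -
  have "((\<lambda>e. e \<odot> of_real (mu e) \<odot> qinner e x) has_sum A x) E
      \<longleftrightarrow> ((\<lambda>e. e \<odot> of_real (lam e) \<odot> qinner e x) has_sum A x) E" for x
    by (rule has_sum_cong) (simp add: assms(2))
  then show ?thesis using assms by (simp add: diagonalises_def)
qed

lemma diagonalises_bounded_ops:
  assumes A: "diagonalises E lam A" and M: "\<And>e. e \<in> E \<Longrightarrow> lam e \<le> M"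
  shows "A \<in> bounded_ops"
proof -
  note eqI = orthonormal_basis_eqI[OF diagonalisesD(1)[OF A]] and coeff = diagonalises_coeff[OF A]
  have "bounded_linear A"
  \<comment> \<open>If \<open>E\<close> is empty, \<open>M\<close> is unconstrained and may be
    negative.\<close>
  proof (rule bounded_linear_intro[where K = "max M 0"])
    show "A (x + y) = A x + A y" for x y
      by (rule eqI) (simp add: coeff qinner_add_right distrib_left)
    show "A (r *\<^sub>R x) = r *\<^sub>R A x" for r x
    proof (rule eqI)
      fix e assume "e \<in> E"
      then show "qinner e (A (r *\<^sub>R x)) = qinner e (r *\<^sub>R A x)"
        by (simp only: coeff qinner_scaleR_right mult.assoc[symmetric] of_real_mult[symmetric]
            mult.commute[of r])
    qed
    show "norm (A x) \<le> norm x * max M 0" for x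
    proof (rule has_sum_norm_le[OF diagonalisesD(4)[OF A]])
      fix F assume F: "finite F" "F \<subseteq> E"
      have "\<bar>lam e\<bar> \<le> max M 0" if "e \<in> F" for e
        using that F M[of e] diagonalisesD(3)[OF A, of e] by auto
      then show "norm (\<Sum>e\<in>F. e \<odot> of_real (lam e) \<odot> qinner e x) \<le> norm x * max M 0"
        using multiplier_norm_sum_le[OF diagonalisesD(2)[OF A] F, of "max M 0" lam x]
        by (simp add: mult.commute)
    qed
  qed
  moreover have "A (x \<odot> a) = A x \<odot> a" for x a
    by (rule eqI) (simp add: coeff qinner_qscale_right mult.assoc)
  ultimately show ?thesis by (simp add: bounded_ops_def)
qed

lemma diagonalises_bounded_eigenvalues:
  assumes A: "diagonalises E lam A" and "A \<in> bounded_ops"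
  obtains M where "0 \<le> M" "\<And>e. e \<in> E \<Longrightarrow> lam e \<le> M"
proof -
  obtain K where K: "0 \<le> K" "\<And>x. norm (A x) \<le> norm x * K"
    using bounded_linear.nonneg_bounded[OF bounded_opsD(1)[OF assms(2)]] by blast
  have "lam e \<le> K" if "e \<in> E" for e
    using K(2)[of e] that diagonalisesD(3)[OF A that]
    by (simp add: diagonalises_eigenvector[OF A] orthonormal_norm[OF diagonalisesD(2)[OF A]])
  with K(1) show thesis by (rule that)
qed

lemma exists_diagonalises:
  assumes E: "orthonormal_basis_of UNIV E"
    and lam: "\<And>e. e \<in> E \<Longrightarrow> 0 \<le> lam e" "\<And>e. e \<in> E \<Longrightarrow> lam e \<le> M"
  obtains A where "diagonalises E lam A" "A \<in> bounded_ops"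
proof -
  have "(\<lambda>e. e \<odot> of_real (lam e) \<odot> qinner e x) summable_on E" for x
  proof (rule multiplier_summable_on)
    show "orthonormal E" using E by (simp add: orthonormal_basis_of_iff)
    show "\<bar>lam e\<bar> \<le> max M 0" if "e \<in> E" for e using lam[OF that] by simp
  qed simp
  then have A: "diagonalises E lam (\<lambda>x. \<Sum>\<^sub>\<infinity>e\<in>E. e \<odot> of_real (lam e) \<odot> qinner e x)"
    using E lam(1) by (simp add: diagonalises_def)
  show thesis by (rule that[OF A diagonalises_bounded_ops[OF A lam(2)]])
qed

text \<open>The vector \<open>x\<close> need not belong to \<open>E\<close>: its coefficients vanish
  wherever \<open>lam e \<noteq> r\<close>. Hence the functional calculus depends on the eigenspaces
  and not on the basis.\<close>

lemma diagonalises_map_eigenvector: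
  assumes A: "diagonalises E lam A" and B: "diagonalises E (\<lambda>e. h (lam e)) B"
    and x: "A x = r *\<^sub>R x"
  shows "B x = h r *\<^sub>R x"
proof (rule orthonormal_basis_eqI[OF diagonalisesD(1)[OF A]])
  fix e assume e: "e \<in> E"
  have "of_real (lam e) * qinner e x = of_real r * qinner e x"
    using diagonalises_coeff[OF A e, of x] by (simp add: x qinner_scaleR_right)
  then have "lam e *\<^sub>R qinner e x = r *\<^sub>R qinner e x" by (simp only: scaleR_conv_of_real)
  then have "lam e = r \<or> qinner e x = 0" by simp
  then show "qinner e (B x) = qinner e (h r *\<^sub>R x)"
    by (auto simp: diagonalises_coeff[OF B e] qinner_scaleR_right)
qed

lemma bounded_ops_eqI:
  assumes E: "orthonormal_basis_of UNIV E" and "S \<in> bounded_ops" "T \<in> bounded_ops"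
    and eq: "\<And>e. e \<in> E \<Longrightarrow> S e = T e"
  shows "S = T"
proof
  fix x
  have x: "((\<lambda>e. e \<odot> qinner e x) has_sum x) E" using E by (simp add: orthonormal_basis_of_iff)
  have "((\<lambda>e. S (e \<odot> qinner e x)) has_sum S x) E"
    by (rule has_sum_bounded_linear[OF bounded_opsD(1)[OF assms(2)] x])
  moreover have "((\<lambda>e. S (e \<odot> qinner e x)) has_sum T x) E
      \<longleftrightarrow> ((\<lambda>e. T (e \<odot> qinner e x)) has_sum T x) E"
    by (rule has_sum_cong) (simp add: bounded_opsD(2)[OF assms(2)] bounded_opsD(2)[OF assms(3)] eq)
  moreover have "((\<lambda>e. T (e \<odot> qinner e x)) has_sum T x) E"
    by (rule has_sum_bounded_linear[OF bounded_opsD(1)[OF assms(3)] x])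
  ultimately show "S x = T x" using has_sum_unique by blast
qed

text \<open>\<open>J e\<close> is in general no basis vector, but it is an eigenvector of
  \<open>A\<close> for \<open>lam e\<close>, so \<open>B\<close> multiplies it by
  \<open>h (lam e)\<close>, just as it does \<open>e\<close>.\<close>

lemma diagonalises_map_commute:
  assumes A: "diagonalises E lam A" and B: "diagonalises E (\<lambda>e. h (lam e)) B" "B \<in> bounded_ops"
    and J: "J \<in> bounded_ops" and comm: "A \<circ> J = J \<circ> A"
  shows "B \<circ> J = J \<circ> B"
proof (rule bounded_ops_eqI[OF diagonalisesD(1)[OF A]])
  show "B \<circ> J \<in> bounded_ops" "J \<circ> B \<in> bounded_ops" using B(2) J by (auto intro: comp_bounded_ops)
  fix e assume e: "e \<in> E"
  note scale = linear_cmul[OF bounded_linear.linear[OF bounded_opsD(1)[OF J]]]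
  have "A (J e) = lam e *\<^sub>R J e"
    using fun_cong[OF comm, of e] by (simp add: diagonalises_eigenvector[OF A e] scale)
  then show "(B \<circ> J) e = (J \<circ> B) e"
    using diagonalises_map_eigenvector[OF A B(1)]
    by (simp add: diagonalises_eigenvector[OF B(1) e] scale)
qed

section \<open>Powers, square roots and absolute values in a diagonalising basis\<close>

lemma pow_op_diagonalises:
  assumes A: "diagonalises E lam A" and bd: "A \<in> bounded_ops" and p: "0 \<le> p"
  shows "diagonalises E (\<lambda>e. lam e powr p) (pow_op A p)" "pow_op A p \<in> bounded_ops"
proof -
  obtain M where M: "\<And>e. e \<in> E \<Longrightarrow> lam e \<le> M"
    using diagonalises_bounded_eigenvalues[OF A bd] by blast
  obtain B where B: "diagonalises E (\<lambda>e. lam e powr p) B" "B \<in> bounded_ops"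
  proof (rule exists_diagonalises[OF diagonalisesD(1)[OF A]])
    show "lam e powr p \<le> M powr p" if "e \<in> E" for e
      using p M[OF that] diagonalisesD(3)[OF A that] by (simp add: powr_mono2)
  qed simp
  have "pow_op A p = B"
    unfolding pow_op_def
  proof (rule the_equality)
    show "\<exists>E lam. orthonormal_basis_of UNIV E \<and> (\<forall>e\<in>E. 0 \<le> lam e) \<and>
        (\<forall>x. ((\<lambda>e. e \<odot> of_real (lam e) \<odot> qinner e x) has_sum A x) E) \<and>
        (\<forall>x. ((\<lambda>e. e \<odot> of_real (lam e powr p) \<odot> qinner e x) has_sum B x) E)"
      using A B(1) unfolding diagonalises_def by blast
    fix C assume "\<exists>E lam. orthonormal_basis_of UNIV E \<and> (\<forall>e\<in>E. 0 \<le> lam e) \<and>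
        (\<forall>x. ((\<lambda>e. e \<odot> of_real (lam e) \<odot> qinner e x) has_sum A x) E) \<and>
        (\<forall>x. ((\<lambda>e. e \<odot> of_real (lam e powr p) \<odot> qinner e x) has_sum C x) E)"
    then obtain F mu where "orthonormal_basis_of UNIV F \<and> (\<forall>e\<in>F. 0 \<le> mu e) \<and>
        (\<forall>x. ((\<lambda>e. e \<odot> of_real (mu e) \<odot> qinner e x) has_sum A x) F) \<and>
        (\<forall>x. ((\<lambda>e. e \<odot> of_real (mu e powr p) \<odot> qinner e x) has_sum C x) F)"
      by (elim exE)
    then have A': "diagonalises F mu A" and C: "diagonalises F (\<lambda>f. mu f powr p) C"
      by (simp_all add: diagonalises_def)
    \<comment> \<open>\<open>C\<close> comes with its own basis \<open>F\<close>. As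
      \<open>B\<close> acts correctly on all eigenvectors of \<open>A\<close>, it has the same
      expansion in \<open>F\<close> as \<open>C\<close>.\<close>
    have "diagonalises F (\<lambda>f. mu f powr p) B"
      by (rule diagonalisesI[OF diagonalisesD(1)[OF A'] _ B(2)])
        (auto intro: diagonalises_map_eigenvector[OF A B(1)] diagonalises_eigenvector[OF A'])
    then show "C = B" by (rule diagonalises_unique[OF C])
  qed
  with B show "diagonalises E (\<lambda>e. lam e powr p) (pow_op A p)" "pow_op A p \<in> bounded_ops" by auto
qed

lemma diagonalises_positive_op:
  assumes A: "diagonalises E lam A"
  shows "positive_op A"
  unfolding positive_op_def
proof
  fix x
  define r where "r = inner x (A x)"
  have termwise: "inner (x \<odot> a) (e \<odot> of_real (lam e) \<odot> qinner e x)
      = qRe a * (lam e * qnorm2 (qinner e x))" for a e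
  proof -
    have "inner (x \<odot> a) (e \<odot> of_real (lam e) \<odot> qinner e x)
        = lam e * qRe (qcnj a * (qcnj (qinner e x) * qinner e x))"
      by (simp only: qscale_of_real_qscale inner_scaleR_right inner_qscale_left
          qinner_qscale_right qinner_cnj[of x e])
    then show ?thesis by (simp add: qcnj_mult_self)
  qed
  have sum: "((\<lambda>e. qRe a * (lam e * qnorm2 (qinner e x))) has_sum inner (x \<odot> a) (A x)) E" for a
    using has_sum_bounded_linear[OF bounded_linear_inner_right diagonalisesD(4)[OF A], of "x \<odot> a" x]
    by (simp only: termwise)
  have sum1: "((\<lambda>e. lam e * qnorm2 (qinner e x)) has_sum r) E"
    using sum[of 1] by (simp add: r_def qscale_one)
  have "0 \<le> r"
    by (rule has_sum_nonneg[OF sum1]) (simp add: diagonalisesD(3)[OF A])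
  have eq: "inner (x \<odot> a) (A x) = qRe a * r" for a
    using has_sum_unique[OF sum has_sum_cmult_right[OF sum1]] .
  \<comment> \<open>\<open>q\<close> is the deviation of \<open>qinner x (A x)\<close> from the real
    number \<open>r\<close>; taking \<open>a = q\<close> in \<open>eq\<close> shows that its squared
    modulus is zero.\<close>
  define q where "q = qinner x (A x) - of_real r"
  have "qRe (qcnj q * q) = inner (x \<odot> q) (A x) - qRe (qcnj q * of_real r)"
    unfolding inner_qscale_left by (simp add: q_def right_diff_distrib)
  also have "\<dots> = 0" unfolding eq by simp
  finally have "q = 0" by (simp add: qcnj_mult_self)
  then show "\<exists>r\<ge>0. qinner x (A x) = of_real r" using \<open>0 \<le> r\<close> by (auto simp: q_def)
qed

text \<open>For \<open>r > 0\<close> the vector \<open>y = S x - sqrt r *\<^sub>R x\<close>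
  satisfies \<open>S y = - sqrt r *\<^sub>R y\<close>, and positivity excludes a negative
  eigenvalue. For \<open>r = 0\<close>, symmetry gives
  \<open>qinner (S x) (S x) = qinner x (S (S x)) = 0\<close>.\<close>

lemma positive_sqrt_eigenvector:
  assumes S: "S \<in> bounded_ops" "positive_op S" and x: "S (S x) = r *\<^sub>R x" and "0 \<le> r"
  shows "S x = sqrt r *\<^sub>R x"
proof (cases "r = 0")
  case True
  have "qinner (S x) (S x) = qinner x (S (S x))" by (rule positive_op_symmetric[OF S])
  then have "qinner (S x) (S x) = 0" using x True by simp
  then show ?thesis using True by (simp add: qinner_self del: of_real_power)
next
  case False
  note lin = bounded_linear.linear[OF bounded_opsD(1)[OF S(1)]]
  define y where "y = S x - sqrt r *\<^sub>R x"
  have "S y = - sqrt r *\<^sub>R y"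
    using \<open>0 \<le> r\<close> by (simp add: y_def linear_diff[OF lin] linear_cmul[OF lin] x algebra_simps)
  then have "inner y (S y) = - (sqrt r * (norm y)\<^sup>2)" by (simp add: power2_norm_eq_inner)
  moreover have "0 \<le> inner y (S y)"
    using S(2) unfolding positive_op_def inner_eq_qRe_qinner by (metis quat_of_real_sel(1))
  ultimately have "sqrt r * (norm y)\<^sup>2 \<le> 0" by simp
  then have "y = 0" using False \<open>0 \<le> r\<close> by (simp add: mult_le_0_iff)
  then show ?thesis by (simp add: y_def)
qed

lemma sqrt_op_diagonalises:
  assumes A: "diagonalises E lam A" and bd: "A \<in> bounded_ops"
  shows "diagonalises E (\<lambda>e. sqrt (lam e)) (sqrt_op A)" "sqrt_op A \<in> bounded_ops"
proof -
  obtain M where M: "\<And>e. e \<in> E \<Longrightarrow> lam e \<le> M"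
    using diagonalises_bounded_eigenvalues[OF A bd] by blast
  obtain R where R: "diagonalises E (\<lambda>e. sqrt (lam e)) R" "R \<in> bounded_ops"
  proof (rule exists_diagonalises[OF diagonalisesD(1)[OF A]])
    show "sqrt (lam e) \<le> sqrt M" if "e \<in> E" for e using M[OF that] by simp
  qed (simp add: diagonalisesD(3)[OF A])
  have "sqrt_op A = R"
    unfolding sqrt_op_def
  proof (rule the_equality)
    note scale = linear_cmul[OF bounded_linear.linear[OF bounded_opsD(1)[OF R(2)]]]
    have "R \<circ> R = A"
    proof (rule bounded_ops_eqI[OF diagonalisesD(1)[OF A] comp_bounded_ops[OF R(2) R(2)] bd])
      fix e assume e: "e \<in> E"
      then show "(R \<circ> R) e = A e"
        using diagonalisesD(3)[OF A e]
        by (simp add: diagonalises_eigenvector[OF R(1)] diagonalises_eigenvector[OF A] scale)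
    qed
    then show "R \<in> bounded_ops \<and> positive_op R \<and> R \<circ> R = A"
      using R diagonalises_positive_op by blast
    fix S assume S: "S \<in> bounded_ops \<and> positive_op S \<and> S \<circ> S = A"
    show "S = R"
    proof (rule bounded_ops_eqI[OF diagonalisesD(1)[OF A]])
      fix e assume e: "e \<in> E"
      have "S (S e) = lam e *\<^sub>R e"
        using S diagonalises_eigenvector[OF A e] by (metis comp_apply)
      then show "S e = R e"
        using S positive_sqrt_eigenvector[of S e "lam e"] diagonalisesD(3)[OF A e]
        by (simp add: diagonalises_eigenvector[OF R(1) e])
    qed (use S R in auto)
  qed
  with R show "diagonalises E (\<lambda>e. sqrt (lam e)) (sqrt_op A)" "sqrt_op A \<in> bounded_ops" by auto
qed

text \<open>\<open>singular_value\<close> is defined through \<open>abs_op\<close>; for the positive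
  operators in the theorem this lets their own eigenvalues be used.\<close>

lemma abs_op_of_diagonalises:
  assumes A: "diagonalises E lam A" and bd: "A \<in> bounded_ops"
  shows "abs_op A = A"
proof -
  have adj: "adj_op A = A"
    by (rule adj_op_eqI) (rule positive_op_symmetric[OF bd diagonalises_positive_op[OF A]])
  have AA: "A \<circ> A \<in> bounded_ops" by (rule comp_bounded_ops[OF bd bd])
  have "diagonalises E (\<lambda>e. lam e * lam e) (A \<circ> A)"
    by (rule diagonalisesI[OF diagonalisesD(1)[OF A] _ AA])
      (simp_all add: diagonalises_eigenvector[OF A]
        linear_cmul[OF bounded_linear.linear[OF bounded_opsD(1)[OF bd]]])
  then have "diagonalises E (\<lambda>e. sqrt (lam e * lam e)) (abs_op A)"
    unfolding abs_op_def adj by (rule sqrt_op_diagonalises(1)[OF _ AA])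
  then have "diagonalises E lam (abs_op A)"
    by (rule diagonalises_cong) (simp add: diagonalisesD(3)[OF A])
  then show ?thesis by (rule diagonalises_unique[OF _ A])
qed

subsection \<open>Compactness in terms of the eigenvalues\<close>

text \<open>Infinitely many such basis vectors would form a bounded set whose images are pairwise at
  distance at least \<epsilon>, so no sequence of distinct images could have a convergent
  subsequence.\<close>

lemma diagonalises_compact_finite:
  assumes A: "diagonalises E lam A" and cpt: "A \<in> compact_ops" and "0 < \<epsilon>"
  shows "finite {e \<in> E. \<epsilon> \<le> lam e}"
proof (rule ccontr)
  assume "infinite {e \<in> E. \<epsilon> \<le> lam e}"
  then obtain f :: "nat \<Rightarrow> 'a" where f: "inj f" "range f \<subseteq> {e \<in> E. \<epsilon> \<le> lam e}"
    using infinite_countable_subset by blast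
  have fE: "f n \<in> E" "\<epsilon> \<le> lam (f n)" for n using f(2) by auto
  have far: "\<epsilon> \<le> dist (A (f m)) (A (f n))" if "m \<noteq> n" for m n
  proof -
    have "f m \<noteq> f n" using f(1) that by (auto dest: injD)
    then have "inner (f m) (f n) = 0"
      using diagonalisesD(2)[OF A] fE by (simp add: orthonormal_def inner_eq_qRe_qinner)
    moreover have "norm (f k) = 1" for k using orthonormal_norm[OF diagonalisesD(2)[OF A] fE(1)] .
    then have "inner (f k) (f k) = 1" for k by (simp add: norm_eq_1)
    ultimately have "(dist (A (f m)) (A (f n)))\<^sup>2 = (lam (f m))\<^sup>2 + (lam (f n))\<^sup>2"
      unfolding dist_norm diagonalises_eigenvector[OF A fE(1)] power2_norm_eq_inner
      by (simp add: inner_diff_left inner_diff_right inner_commute power2_eq_square)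
    then have "\<epsilon>\<^sup>2 \<le> (dist (A (f m)) (A (f n)))\<^sup>2"
      using power_mono[OF fE(2)[of m], of 2] \<open>0 < \<epsilon>\<close> by (simp add: add_increasing2)
    then show ?thesis by (rule power2_le_imp_le) simp
  qed
  have "bounded (range f)"
    by (rule boundedI[where B = 1]) (auto simp: orthonormal_norm[OF diagonalisesD(2)[OF A] fE(1)])
  then have "compact (closure (A ` range f))" by (rule compact_opsD(2)[OF cpt])
  moreover have "\<forall>n. A (f n) \<in> closure (A ` range f)"
    using closure_subset[of "A ` range f"] by auto
  ultimately obtain l r where r: "strict_mono r" "((\<lambda>n. A (f n)) \<circ> r) \<longlonglongrightarrow> l"
    unfolding compact_def by metis
  from LIMSEQ_imp_Cauchy[OF r(2)] obtain N where
    "\<And>m n. N \<le> m \<Longrightarrow> N \<le> n \<Longrightarrow> dist (A (f (r m))) (A (f (r n))) < \<epsilon>"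
    using \<open>0 < \<epsilon>\<close> unfolding Cauchy_def comp_def by meson
  then have "dist (A (f (r N))) (A (f (r (Suc N)))) < \<epsilon>" by simp
  moreover have "r N \<noteq> r (Suc N)" using r(1) by (metis lessI less_irrefl strict_monoD)
  ultimately show False using far by fastforce
qed

lemma compact_closure_approx:
  fixes S :: "'a::complete_space set"
  assumes approx: "\<And>\<epsilon>. 0 < \<epsilon> \<Longrightarrow> \<exists>K. compact K \<and> S \<subseteq> (\<Union>x\<in>K. ball x \<epsilon>)"
  shows "compact (closure S)"
  unfolding compact_eq_totally_bounded
proof (intro conjI allI impI)
  show "complete (closure S)" by (simp add: complete_eq_closed)
  fix \<epsilon> :: real assume "0 < \<epsilon>"
  then have "0 < \<epsilon> / 3" by simp
  from approx[OF this] obtain K where K: "compact K" "S \<subseteq> (\<Union>x\<in>K. ball x (\<epsilon> / 3))" by blast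
  then obtain k where k: "finite k" "K \<subseteq> (\<Union>x\<in>k. ball x (\<epsilon> / 3))"
    using \<open>0 < \<epsilon> / 3\<close> unfolding compact_eq_totally_bounded by blast
  \<comment> \<open>Two approximations within a third of \<epsilon> each; closed balls are kept so
    that the inclusion passes to the closure, and the last third makes the balls open again.\<close>
  have "S \<subseteq> (\<Union>x\<in>k. cball x (2 * \<epsilon> / 3))"
  proof
    fix s assume "s \<in> S"
    then obtain x where x: "x \<in> K" "dist x s < \<epsilon> / 3" using K(2) by auto
    then obtain z where z: "z \<in> k" "dist z x < \<epsilon> / 3" using k(2) by auto
    have "dist z s \<le> 2 * \<epsilon> / 3" using dist_triangle[of z s x] x z by linarith
    then show "s \<in> (\<Union>x\<in>k. cball x (2 * \<epsilon> / 3))" using z by auto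
  qed
  then have "closure S \<subseteq> (\<Union>x\<in>k. cball x (2 * \<epsilon> / 3))"
    by (rule closure_minimal) (use k(1) in auto)
  also have "\<dots> \<subseteq> (\<Union>x\<in>k. ball x \<epsilon>)" using \<open>0 < \<epsilon>\<close> by (intro UN_mono) auto
  finally show "\<exists>k. finite k \<and> closure S \<subseteq> (\<Union>x\<in>k. ball x \<epsilon>)" using k(1) by blast
qed

text \<open>Compactness comes from the cube of the four real coordinates, mapped continuously into
  the space.\<close>

lemma compact_qscale_cell:
  fixes e :: "'a::quaternionic_hilbert"
  shows "\<exists>K. compact K \<and> (\<forall>a. qnorm2 a \<le> C \<longrightarrow> e \<odot> a \<in> K)"
proof -
  let ?I = "{- sqrt C .. sqrt C}"
  let ?f = "\<lambda>(r, s, t, u). r *\<^sub>R e + s *\<^sub>R (e \<odot> Quat 0 1 0 0) + t *\<^sub>R (e \<odot> Quat 0 0 1 0)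
      + u *\<^sub>R (e \<odot> Quat 0 0 0 1)"
  have "compact (?f ` (?I \<times> ?I \<times> ?I \<times> ?I))"
    by (intro compact_continuous_image compact_Times compact_Icc)
      (auto simp: case_prod_beta intro!: continuous_intros)
  moreover have "e \<odot> a \<in> ?f ` (?I \<times> ?I \<times> ?I \<times> ?I)" if "qnorm2 a \<le> C" for a
  proof (rule image_eqI)
    have scale: "r *\<^sub>R (e \<odot> b) = e \<odot> (of_real r * b)" for r b
      by (metis qscale_of_real_qscale qscale_qscale)
    have "a = of_real (qRe a) * 1 + of_real (qIm1 a) * Quat 0 1 0 0 + of_real (qIm2 a) * Quat 0 0 1 0
        + of_real (qIm3 a) * Quat 0 0 0 1"
      by (simp add: quat_eq_iff)
    from arg_cong[OF this, of "(\<odot>) e"] show "e \<odot> a = ?f (qRe a, qIm1 a, qIm2 a, qIm3 a)"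
      by (simp only: qscale_add_right scale[symmetric] qscale_one case_prod_conv)
    have "\<bar>x\<bar> \<le> sqrt C" if "x\<^sup>2 \<le> C" for x
      using real_sqrt_le_mono[OF that] by simp
    moreover have "(qRe a)\<^sup>2 \<le> C" "(qIm1 a)\<^sup>2 \<le> C" "(qIm2 a)\<^sup>2 \<le> C" "(qIm3 a)\<^sup>2 \<le> C"
      using that zero_le_power2[of "qRe a"] zero_le_power2[of "qIm1 a"]
        zero_le_power2[of "qIm2 a"] zero_le_power2[of "qIm3 a"]
      unfolding qnorm2_def by linarith+
    ultimately show "(qRe a, qIm1 a, qIm2 a, qIm3 a) \<in> ?I \<times> ?I \<times> ?I \<times> ?I"
      by (simp add: abs_le_iff minus_le_iff)
  qed
  ultimately show ?thesis by blast
qed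

lemma compact_finite_combinations:
  fixes F :: "'a::quaternionic_hilbert set"
  assumes "finite F"
  shows "\<exists>K. compact K \<and> (\<forall>c. (\<forall>e\<in>F. qnorm2 (c e) \<le> C) \<longrightarrow> (\<Sum>e\<in>F. e \<odot> c e) \<in> K)"
  using assms
proof (induction F)
  case empty
  have "compact {0 :: 'a}" by simp
  then show ?case by (intro exI[of _ "{0}"]) simp
next
  case (insert e F)
  then obtain K where K: "compact K" "\<And>c. \<forall>e\<in>F. qnorm2 (c e) \<le> C \<Longrightarrow> (\<Sum>e\<in>F. e \<odot> c e) \<in> K"
    by blast
  obtain L where L: "compact L" "\<And>a. qnorm2 a \<le> C \<Longrightarrow> e \<odot> a \<in> L"
    using compact_qscale_cell[of C e] by blast
  have "compact {x + y | x y. x \<in> L \<and> y \<in> K}" by (rule compact_sums[OF L(1) K(1)])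
  moreover have "(\<Sum>f\<in>insert e F. f \<odot> c f) \<in> {x + y | x y. x \<in> L \<and> y \<in> K}"
    if "\<forall>f\<in>insert e F. qnorm2 (c f) \<le> C" for c
    using that K(2)[of c] L(2)[of "c e"] insert.hyps by auto
  ultimately show ?case by blast
qed

text \<open>The finitely many terms with \<open>\<delta> \<le> lam e\<close> stay in a compact set,
  as their coefficients are bounded through \<open>M\<close> and Bessel's inequality; the remaining
  terms sum to norm at most \<open>\<delta> * R\<close>.\<close>

lemma diagonalises_finite_compact:
  assumes A: "diagonalises E lam A" and bd: "A \<in> bounded_ops"
    and fin: "\<And>\<epsilon>. 0 < \<epsilon> \<Longrightarrow> finite {e \<in> E. \<epsilon> \<le> lam e}"
  shows "A \<in> compact_ops"
proof -
  obtain M where M: "0 \<le> M" "\<And>e. e \<in> E \<Longrightarrow> lam e \<le> M"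
    using diagonalises_bounded_eigenvalues[OF A bd] by blast
  note E = diagonalisesD(2)[OF A] and lam0 = diagonalisesD(3)[OF A]
  have "compact (closure (A ` B))" if B: "bounded B" for B
  proof (rule compact_closure_approx)
    fix \<epsilon> :: real assume "0 < \<epsilon>"
    obtain R where R: "0 < R" "\<And>x. x \<in> B \<Longrightarrow> norm x \<le> R"
      using B bounded_pos by metis
    \<comment> \<open>The factor 2 makes \<open>\<delta> * R\<close> strictly less than \<epsilon>,
      as open balls require.\<close>
    define \<delta> where "\<delta> = \<epsilon> / (2 * R)"
    have \<delta>: "0 < \<delta>" "\<delta> * R < \<epsilon>" using R(1) \<open>0 < \<epsilon>\<close> by (auto simp: \<delta>_def)
    define F where "F = {e \<in> E. \<delta> \<le> lam e}"
    have F: "finite F" "F \<subseteq> E" using fin[OF \<delta>(1)] by (auto simp: F_def)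
    obtain K where K: "compact K"
      "\<And>c. \<forall>e\<in>F. qnorm2 (c e) \<le> M\<^sup>2 * R\<^sup>2 \<Longrightarrow> (\<Sum>e\<in>F. e \<odot> c e) \<in> K"
      using compact_finite_combinations[OF F(1)] by meson
    have "A x \<in> (\<Union>y\<in>K. ball y \<epsilon>)" if "x \<in> B" for x
    proof -
      let ?g = "\<lambda>e. e \<odot> of_real (lam e) \<odot> qinner e x"
      have "(?g has_sum (A x - sum ?g F)) (E - F)"
        using has_sum_Diff[OF diagonalisesD(4)[OF A] has_sum_finite[OF F(1)] F(2)] .
      then have "norm (A x - sum ?g F) \<le> \<delta> * norm x"
      proof (rule has_sum_norm_le)
        fix G assume G: "finite G" "G \<subseteq> E - F"
        then show "norm (sum ?g G) \<le> \<delta> * norm x"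
          using \<delta>(1) lam0 by (intro multiplier_norm_sum_le[OF E]) (fastforce simp: F_def)+
      qed
      also have "\<dots> \<le> \<delta> * R" using R(2)[OF that] \<delta>(1) by (intro mult_left_mono) auto
      finally have "A x \<in> ball (sum ?g F) \<epsilon>"
        using \<delta>(2) by (simp add: dist_norm norm_minus_commute)
      moreover have "sum ?g F \<in> K"
        unfolding qscale_qscale
      proof (rule K(2), rule ballI)
        fix e assume "e \<in> F"
        then have e: "e \<in> E" using F by blast
        have "qnorm2 (qinner e x) \<le> (norm x)\<^sup>2" using bessel[OF E, of "{e}" x] e by simp
        also have "\<dots> \<le> R\<^sup>2" using R(2)[OF that] by (intro power_mono) auto
        finally show "qnorm2 (of_real (lam e) * qinner e x) \<le> M\<^sup>2 * R\<^sup>2"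
          unfolding qnorm2_of_real_mult using M(2)[OF e] lam0[OF e]
          by (intro mult_mono power_mono) auto
      qed
      ultimately show ?thesis by blast
    qed
    then show "\<exists>K. compact K \<and> A ` B \<subseteq> (\<Union>x\<in>K. ball x \<epsilon>)" using K(1) by blast
  qed
  with bd show ?thesis by (simp add: compact_ops_def)
qed

subsection \<open>Decreasing enumerations\<close>

text \<open>\<open>s\<close> is a generalised inverse of the counting function \<open>N\<close>: the
  largest positive value \<open>lam e\<close> that more than \<open>n\<close> elements reach, or
  zero if there is none. No sorting of \<open>E\<close> is involved.\<close>

lemma exists_decreasing_enumeration:
  fixes lam :: "'b \<Rightarrow> real"
  assumes fin: "\<And>r. 0 < r \<Longrightarrow> finite {e \<in> E. r \<le> lam e}"
  obtains s :: "nat \<Rightarrow> real" where "decseq s" "\<And>n. 0 \<le> s n"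
    "\<And>r n. 0 < r \<Longrightarrow> r \<le> s n \<longleftrightarrow> n < card {e \<in> E. r \<le> lam e}"
proof -
  define N where "N r = card {e \<in> E. r \<le> lam e}" for r
  define X where "X n = insert 0 {lam e | e. e \<in> E \<and> 0 < lam e \<and> n < N (lam e)}" for n :: nat
  define s where "s n = Sup (X n)" for n
  have bdd: "bdd_above (X n)" for n
  proof (rule bdd_aboveI)
    fix x assume x: "x \<in> X n"
    \<comment> \<open>The 1 is an arbitrary positive threshold: only finitely many values reach
      it.\<close>
    let ?Y = "insert 1 (lam ` {e \<in> E. 1 \<le> lam e})"
    have "finite ?Y" using fin[of 1] by simp
    then have Y: "y \<le> Max ?Y" if "y \<in> ?Y" for y using that by (rule Max_ge)
    show "x \<le> Max ?Y"
    proof (cases "1 \<le> x")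
      case True
      then show ?thesis using x by (intro Y) (auto simp: X_def)
    qed (use Y[of 1] in auto)
  qed
  have nonneg: "0 \<le> s n" for n
    unfolding s_def by (rule cSup_upper[OF _ bdd]) (simp add: X_def)
  have iff: "r \<le> s n \<longleftrightarrow> n < N r" if r: "0 < r" for r n
  proof
    assume n: "n < N r"
    define Y where "Y = {e \<in> E. r \<le> lam e}"
    have "Y \<noteq> {}" using n unfolding N_def Y_def[symmetric] by (metis card.empty not_less_zero)
    then have Y: "finite (lam ` Y)" "lam ` Y \<noteq> {}" using fin[OF r] by (simp_all add: Y_def)
    then obtain e where e: "e \<in> Y" "Min (lam ` Y) = lam e" using Min_in by blast
    \<comment> \<open>\<open>lam e\<close> is the least value not below \<open>r\<close>, so both
      thresholds select the same elements and \<open>lam e\<close> itself belongs to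
      \<open>X n\<close>.\<close>
    have "{f \<in> E. lam e \<le> lam f} = Y"
      using Min_le[OF Y(1)] e by (fastforce simp: Y_def)
    then have "N (lam e) = N r" by (simp add: N_def Y_def)
    then have "lam e \<in> X n" using e n r by (auto simp: X_def Y_def)
    then have "lam e \<le> s n" unfolding s_def by (rule cSup_upper[OF _ bdd])
    then show "r \<le> s n" using e by (simp add: Y_def)
  next
    assume le: "r \<le> s n"
    show "n < N r"
    proof (rule ccontr)
      assume n: "\<not> n < N r"
      \<comment> \<open>It must be excluded that members of \<open>X n\<close> below
        \<open>r\<close> have supremum \<open>r\<close>. Only finitely many values lie between
        \<open>r / 2\<close> and \<open>r\<close>, so \<open>Max Y\<close> is a bound strictly below
        \<open>r\<close>.\<close>
      define Y where "Y = insert (r / 2) (lam ` {e \<in> E. r / 2 \<le> lam e \<and> lam e < r})"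
      have "finite {e \<in> E. r / 2 \<le> lam e \<and> lam e < r}"
        by (rule finite_subset[OF _ fin[of "r / 2"]]) (use r in auto)
      then have Y: "finite Y" "Y \<noteq> {}" by (auto simp: Y_def)
      have "Max Y < r" using Y r by (subst Max_less_iff) (auto simp: Y_def)
      moreover have "s n \<le> Max Y"
        unfolding s_def
      proof (rule cSup_least)
        fix x assume "x \<in> X n"
        then consider "x = 0" | e where "x = lam e" "e \<in> E" "n < N (lam e)"
          by (auto simp: X_def)
        then show "x \<le> Max Y"
        proof cases
          case 1
          have "r / 2 \<le> Max Y" using Y(1) by (intro Max_ge) (auto simp: Y_def)
          with 1 r show ?thesis by simp
        next
          case 2
          have "lam e < r"
          proof (rule ccontr)
            assume "\<not> lam e < r"
            then have "N (lam e) \<le> N r"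
              unfolding N_def by (intro card_mono fin[OF r]) auto
            with 2 n show False by simp
          qed
          show ?thesis
          proof (cases "r / 2 \<le> lam e")
            case True
            then show ?thesis using 2 \<open>lam e < r\<close> Y(1) by (intro Max_ge) (auto simp: Y_def)
          next
            case False
            moreover have "r / 2 \<le> Max Y" using Y(1) by (intro Max_ge) (auto simp: Y_def)
            ultimately show ?thesis using 2 by simp
          qed
        qed
      qed (simp add: X_def)
      ultimately show False using le by simp
    qed
  qed
  have "decseq s"
    unfolding decseq_def
  proof (intro allI impI)
    fix m n :: nat assume "m \<le> n"
    show "s n \<le> s m"
    proof (cases "s n = 0")
      case False
      then have "0 < s n" using nonneg[of n] by simp
      then show ?thesis using iff[of "s n" n] iff[of "s n" m] \<open>m \<le> n\<close> by simp
    qed (simp add: nonneg)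
  qed
  then show thesis using nonneg iff unfolding N_def by (rule that)
qed

text \<open>The fibre over \<open>r\<close> is the difference of two initial segments of the
  naturals, for the conditions \<open>r \<le> s n\<close> and \<open>r < s n\<close>.\<close>

lemma card_fibre_of_enumeration:
  fixes lam :: "'b \<Rightarrow> real" and s :: "nat \<Rightarrow> real"
  assumes fin: "\<And>r. 0 < r \<Longrightarrow> finite {e \<in> E. r \<le> lam e}"
    and iff: "\<And>r n. 0 < r \<Longrightarrow> r \<le> s n \<longleftrightarrow> n < card {e \<in> E. r \<le> lam e}"
    and r: "0 < r"
  shows "finite {n. s n = r}" "card {n. s n = r} = card {e \<in> E. lam e = r}"
proof -
  let ?Y = "{e \<in> E. r < lam e}"
  have Y: "finite ?Y" by (rule finite_subset[OF _ fin[OF r]]) auto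
  have less: "r < s n \<longleftrightarrow> n < card ?Y" for n
  proof
    assume "r < s n"
    then have "n < card {e \<in> E. s n \<le> lam e}" using iff[of "s n" n] r by simp
    also have "\<dots> \<le> card ?Y" by (rule card_mono[OF Y]) (use \<open>r < s n\<close> in auto)
    finally show "n < card ?Y" .
  next
    assume n: "n < card ?Y"
    have ne: "lam ` ?Y \<noteq> {}"
    proof
      assume "lam ` ?Y = {}"
      then have "?Y = {}" by blast
      with n show False by (simp only: card.empty)
    qed
    \<comment> \<open>The least value above \<open>r\<close> replaces the strict threshold by a
      non-strict one, to which \<open>iff\<close> applies.\<close>
    define m where "m = Min (lam ` ?Y)"
    have m: "m \<in> lam ` ?Y" unfolding m_def using Y ne by (intro Min_in) auto
    have "?Y \<subseteq> {e \<in> E. m \<le> lam e}" using Y by (auto simp: m_def intro: Min_le)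
    then have "card ?Y \<le> card {e \<in> E. m \<le> lam e}"
      using fin[of m] m r by (intro card_mono) auto
    then have "m \<le> s n" using iff[of m n] m n r by auto
    then show "r < s n" using m by auto
  qed
  have eq: "{n. s n = r} = {..<card {e \<in> E. r \<le> lam e}} - {..<card ?Y}"
  proof (rule set_eqI)
    fix n
    have "s n = r \<longleftrightarrow> r \<le> s n \<and> \<not> r < s n" by auto
    then show "n \<in> {n. s n = r} \<longleftrightarrow> n \<in> {..<card {e \<in> E. r \<le> lam e}} - {..<card ?Y}"
      by (auto simp: iff[OF r] less)
  qed
  then show "finite {n. s n = r}" by simp
  have "card ?Y \<le> card {e \<in> E. r \<le> lam e}" by (rule card_mono[OF fin[OF r]]) auto
  then have "card {n. s n = r} = card {e \<in> E. r \<le> lam e} - card ?Y"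
    unfolding eq by (subst card_Diff_subset) auto
  also have "\<dots> = card ({e \<in> E. r \<le> lam e} - ?Y)"
    by (rule card_Diff_subset[symmetric, OF Y]) auto
  also have "{e \<in> E. r \<le> lam e} - ?Y = {e \<in> E. lam e = r}" by auto
  finally show "card {n. s n = r} = card {e \<in> E. lam e = r}" .
qed

lemma decseq_le_iff_card:
  assumes "decseq s" and fin: "finite {n. r \<le> s n}"
  shows "(r :: real) \<le> s n \<longleftrightarrow> n < card {n. r \<le> s n}"
proof
  assume "r \<le> s n"
  then have "{..n} \<subseteq> {n. r \<le> s n}" using decseqD[OF assms(1)] by (auto intro: order_trans)
  then have "card {..n} \<le> card {n. r \<le> s n}" by (rule card_mono[OF fin])
  then show "n < card {n. r \<le> s n}" by simp
next
  assume n: "n < card {n. r \<le> s n}"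
  show "r \<le> s n"
  proof (rule ccontr)
    assume "\<not> r \<le> s n"
    then have "{n. r \<le> s n} \<subseteq> {..<n}"
      using decseqD[OF assms(1)] by (auto simp: not_le[symmetric] intro: order_trans)
    then have "card {n. r \<le> s n} \<le> card {..<n}" by (rule card_mono[OF finite_lessThan])
    with n show False by simp
  qed
qed

text \<open>Equal fibres over every value not below \<open>r\<close> add up to equal counts, since
  \<open>s\<close> and \<open>lam\<close> take the same finite set of such values. Finiteness of the
  fibres is a separate hypothesis because \<open>card\<close> is 0 on infinite sets.\<close>

lemma enumeration_of_card_fibre:
  fixes lam :: "'b \<Rightarrow> real" and s :: "nat \<Rightarrow> real"
  assumes fin: "\<And>r. 0 < r \<Longrightarrow> finite {e \<in> E. r \<le> lam e}" and "decseq s"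
    and fib: "\<And>r. 0 < r \<Longrightarrow> finite {n. s n = r}"
      "\<And>r. 0 < r \<Longrightarrow> card {n. s n = r} = card {e \<in> E. lam e = r}"
    and r: "0 < r"
  shows "r \<le> s n \<longleftrightarrow> n < card {e \<in> E. r \<le> lam e}"
proof -
  define X Y where "X = {n. r \<le> s n}" and "Y = {e \<in> E. r \<le> lam e}"
  have Y: "finite Y" using fin[OF r] by (simp add: Y_def)
  have fibres: "{n \<in> X. s n = v} = {n. s n = v}" "{e \<in> Y. lam e = v} = {e \<in> E. lam e = v}"
    if "r \<le> v" for v
    using that by (auto simp: X_def Y_def)
  have fibE: "finite {e \<in> E. lam e = v}" if "r \<le> v" for v
    by (rule finite_subset[OF _ fin[of v]]) (use that r in auto)
  have pos: "0 < card {n. s n = v}" if "v \<in> s ` X" for v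
    using that r fib(1)[of v] by (auto simp: card_gt_0_iff X_def)
  have "s ` X \<subseteq> lam ` Y"
  proof
    fix v assume v: "v \<in> s ` X"
    then have "r \<le> v" by (auto simp: X_def)
    then have "0 < card {e \<in> E. lam e = v}" using pos[OF v] fib(2)[of v] r by simp
    then show "v \<in> lam ` Y" using \<open>r \<le> v\<close> by (auto simp: card_gt_0_iff Y_def)
  qed
  moreover have "lam ` Y \<subseteq> s ` X"
  proof
    fix v assume v: "v \<in> lam ` Y"
    then have "r \<le> v" by (auto simp: Y_def)
    have "0 < card {e \<in> E. lam e = v}"
      using v fibE[OF \<open>r \<le> v\<close>] by (auto simp: card_gt_0_iff Y_def)
    then have "0 < card {n. s n = v}" using fib(2)[of v] r \<open>r \<le> v\<close> by simp
    then show "v \<in> s ` X" using \<open>r \<le> v\<close> by (auto simp: card_gt_0_iff X_def)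
  qed
  ultimately have im: "s ` X = lam ` Y" by blast
  have "X \<subseteq> (\<Union>v\<in>lam ` Y. {n. s n = v})" using im by auto
  moreover have "finite (\<Union>v\<in>lam ` Y. {n. s n = v})"
    using Y r by (intro finite_UN_I finite_imageI fib(1)) (auto simp: Y_def)
  ultimately have X: "finite X" by (rule finite_subset)
  have "card X = (\<Sum>v\<in>s ` X. card {n \<in> X. s n = v})"
    using sum.image_gen[OF X, of "\<lambda>_. 1 :: nat" s] by simp
  also have "\<dots> = (\<Sum>v\<in>lam ` Y. card {e \<in> Y. lam e = v})"
  proof (rule sum.cong[OF im])
    fix v assume "v \<in> lam ` Y"
    then have "r \<le> v" by (auto simp: Y_def)
    then show "card {n \<in> X. s n = v} = card {e \<in> Y. lam e = v}"
      using fib(2)[of v] r by (simp add: fibres)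
  qed
  also have "\<dots> = card Y"
    using sum.image_gen[OF Y, of "\<lambda>_. 1 :: nat" lam] by simp
  finally show ?thesis
    using decseq_le_iff_card[OF \<open>decseq s\<close>, of r n] X by (simp add: X_def Y_def)
qed

lemma nonneg_real_eqI:
  fixes x y :: real
  assumes "0 \<le> x" "0 \<le> y" "\<And>r. 0 < r \<Longrightarrow> r \<le> x \<longleftrightarrow> r \<le> y"
  shows "x = y"
  using assms(1,2) assms(3)[of x] assms(3)[of y] by (cases "x = 0"; cases "y = 0") auto

subsection \<open>Singular values\<close>

lemma eigenspace_basis:
  assumes A: "diagonalises E lam A"
  shows "orthonormal_basis_of (eigenspace A r) {e \<in> E. lam e = r}"
proof -
  have eigenspace: "x \<in> eigenspace A r \<longleftrightarrow> A x = r *\<^sub>R x" for x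
    by (simp add: eigenspace_def qscale_of_real)
  have "((\<lambda>e. e \<odot> qinner e x) has_sum x) {e \<in> E. lam e = r}" if x: "A x = r *\<^sub>R x" for x
  proof -
    have zero: "qinner e x = 0" if e: "e \<in> E" "lam e \<noteq> r" for e
    proof -
      have "lam e *\<^sub>R qinner e x = r *\<^sub>R qinner e x"
        using diagonalises_coeff[OF A e(1), of x]
        by (simp add: x qinner_scaleR_right scaleR_conv_of_real)
      then show ?thesis using e(2) by simp
    qed
    have "((\<lambda>e. e \<odot> qinner e x) has_sum x) E"
      using diagonalisesD(1)[OF A] by (simp add: orthonormal_basis_of_iff)
    moreover have "((\<lambda>e. e \<odot> qinner e x) has_sum x) E
        \<longleftrightarrow> ((\<lambda>e. e \<odot> qinner e x) has_sum x) {e \<in> E. lam e = r}"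
      by (rule has_sum_cong_neutral) (auto simp: zero)
    ultimately show ?thesis by blast
  qed
  moreover have "orthonormal {e \<in> E. lam e = r}"
    by (rule orthonormal_subset[OF diagonalisesD(2)[OF A]]) auto
  moreover have "{e \<in> E. lam e = r} \<subseteq> eigenspace A r"
    unfolding subset_iff eigenspace using diagonalises_eigenvector[OF A] by blast
  ultimately show ?thesis by (simp add: orthonormal_basis_of_iff eigenspace)
qed

lemma singular_value_le_iff:
  assumes A: "diagonalises E lam (abs_op T)"
    and fin: "\<And>r. 0 < r \<Longrightarrow> finite {e \<in> E. r \<le> lam e}"
  shows "0 \<le> singular_value T n"
    and "0 < r \<Longrightarrow> r \<le> singular_value T n \<longleftrightarrow> n < card {e \<in> E. r \<le> lam e}"
proof -
  define P where "P s \<longleftrightarrow> decseq s \<and> (\<forall>n. 0 \<le> s n) \<and>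
     (\<forall>r>0. \<exists>F. orthonormal_basis_of (eigenspace (abs_op T) r) F \<and> {n. s n = r} \<approx> F)"
    for s :: "nat \<Rightarrow> real"
  have fin_eq: "finite {e \<in> E. lam e = r}" if "0 < r" for r
    by (rule finite_subset[OF _ fin[OF that]]) auto
  have iff: "r \<le> s n \<longleftrightarrow> n < card {e \<in> E. r \<le> lam e}" if s: "P s" and r: "0 < r" for s r n
  proof -
    have "finite {n. s n = v} \<and> card {n. s n = v} = card {e \<in> E. lam e = v}" if v: "0 < v" for v
    proof -
      obtain F where F: "orthonormal_basis_of (eigenspace (abs_op T) v) F" "{n. s n = v} \<approx> F"
        using s v unfolding P_def by blast
      have "finite F" "card F = card {e \<in> E. lam e = v}"
        using orthonormal_basis_card_eq[OF eigenspace_basis[OF A] F(1) fin_eq[OF v]] .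
      moreover have "finite {n. s n = v}"
        using F(2) \<open>finite F\<close> eqpoll_finite_iff by blast
      ultimately show ?thesis using F(2) eqpoll_iff_card by metis
    qed
    moreover have "decseq s" using s by (simp add: P_def)
    ultimately show ?thesis using r by (intro enumeration_of_card_fibre[OF fin]) auto
  qed
  obtain s where s: "decseq s" "\<And>n. 0 \<le> s n"
    "\<And>r n. 0 < r \<Longrightarrow> r \<le> s n \<longleftrightarrow> n < card {e \<in> E. r \<le> lam e}"
    using exists_decreasing_enumeration[OF fin] by blast
  have "P s"
    unfolding P_def
  proof (intro conjI allI impI)
    fix r :: real assume r: "0 < r"
    have "{n. s n = r} \<approx> {e \<in> E. lam e = r}"
      using card_fibre_of_enumeration[OF fin s(3) r] fin_eq[OF r] eqpoll_iff_card by blast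
    then show "\<exists>F. orthonormal_basis_of (eigenspace (abs_op T) r) F \<and> {n. s n = r} \<approx> F"
      using eigenspace_basis[OF A] by blast
  qed (use s in auto)
  moreover have "s' = s" if "P s'" for s'
  proof
    fix n
    show "s' n = s n"
    proof (rule nonneg_real_eqI)
      show "0 \<le> s' n" "0 \<le> s n" using that s(2) by (auto simp: P_def)
      show "r \<le> s' n \<longleftrightarrow> r \<le> s n" if "0 < r" for r
        using iff[OF \<open>P s'\<close> that] s(3)[OF that] by simp
    qed
  qed
  ultimately have "singular_value T = s"
    unfolding singular_value_def P_def[symmetric] by (rule the_equality)
  then show "0 \<le> singular_value T n"
    and "0 < r \<Longrightarrow> r \<le> singular_value T n \<longleftrightarrow> n < card {e \<in> E. r \<le> lam e}"
    using s by auto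
qed

section \<open>Singular values and norms under powers\<close>

lemma le_powr_iff:
  fixes x r q :: real
  assumes "0 < r" "0 \<le> x" "0 < q"
  shows "r \<le> x powr q \<longleftrightarrow> r powr (1 / q) \<le> x"
proof
  assume "r \<le> x powr q"
  then have "r powr (1 / q) \<le> (x powr q) powr (1 / q)" using assms by (intro powr_mono2) auto
  then show "r powr (1 / q) \<le> x" using assms by (simp add: powr_powr)
next
  assume "r powr (1 / q) \<le> x"
  then have "(r powr (1 / q)) powr q \<le> x powr q" using assms by (intro powr_mono2) auto
  then show "r \<le> x powr q" using assms by (simp add: powr_powr)
qed

text \<open>\<open>S\<close> need not be a power of \<open>T\<close>: only the absolute values must
  be diagonal in the same basis. This covers \<open>T\<^sup>*T\<close> with \<open>q = 2\<close> as
  well as the power of the absolute value.\<close>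

lemma singular_value_powr:
  assumes A: "diagonalises E lam (abs_op T)"
    and fin: "\<And>r. 0 < r \<Longrightarrow> finite {e \<in> E. r \<le> lam e}"
    and B: "diagonalises E (\<lambda>e. lam e powr q) (abs_op S)" and q: "0 < q"
  shows "singular_value S n = singular_value T n powr q"
proof (rule nonneg_real_eqI)
  have set_eq: "{e \<in> E. r \<le> lam e powr q} = {e \<in> E. r powr (1 / q) \<le> lam e}" if "0 < r" for r
    using le_powr_iff[OF that _ q] diagonalisesD(3)[OF A] by auto
  have fin': "finite {e \<in> E. r \<le> lam e powr q}" if "0 < r" for r
    unfolding set_eq[OF that] using fin that by simp
  show "0 \<le> singular_value S n" by (rule singular_value_le_iff(1)[OF B fin'])
  fix r :: real assume r: "0 < r"
  have "r \<le> singular_value S n \<longleftrightarrow> n < card {e \<in> E. r \<le> lam e powr q}"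
    by (rule singular_value_le_iff(2)[OF B fin' r])
  also have "\<dots> \<longleftrightarrow> r powr (1 / q) \<le> singular_value T n"
    unfolding set_eq[OF r] using singular_value_le_iff(2)[OF A fin, of "r powr (1 / q)" n] r by simp
  also have "\<dots> \<longleftrightarrow> r \<le> singular_value T n powr q"
    by (rule le_powr_iff[symmetric, OF r singular_value_le_iff(1)[OF A fin] q])
  finally show "r \<le> singular_value S n \<longleftrightarrow> r \<le> singular_value T n powr q" .
qed simp

text \<open>Infinity is included, so the norm identities also hold outside the Schatten
  classes.\<close>

lemma ennreal_powr_inverse_powr:
  assumes "0 < p"
  shows "ennreal_powr (ennreal_powr x (1 / p)) p = x"
  using assms by (cases x) (auto simp: ennreal_powr_def powr_powr)

lemma ennreal_powr_1: "ennreal_powr x 1 = x"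
  by (cases x) (auto simp: ennreal_powr_def)

lemma commutator_eq_0_iff:
  "commutator T J = (\<lambda>_. 0) \<longleftrightarrow> T \<circ> J = J \<circ> T"
  by (auto simp: commutator_def fun_eq_iff)

text \<open>Moving \<open>J\<close> across the product twice produces two minus signs that cancel,
  so the adjoint of \<open>T\<close> commutes with \<open>J\<close> as well.\<close>

lemma adj_op_comp_commute:
  assumes T: "T \<in> bounded_ops" and J: "J \<in> bounded_ops" "anti_selfadjoint J"
    and comm: "T \<circ> J = J \<circ> T"
  shows "(adj_op T \<circ> T) \<circ> J = J \<circ> (adj_op T \<circ> T)"
proof -
  have skew: "qinner (J x) y = - qinner x (J y)" for x y
  proof -
    have "- qinner (J x) y = qinner x (J y)"
      using qinner_adj_op_left[OF J(1), of x y] J(2)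
      by (simp add: anti_selfadjoint_def qinner_minus_left)
    then show ?thesis by (metis minus_minus)
  qed
  have TJ: "T (J x) = J (T x)" for x using fun_cong[OF comm, of x] by simp
  have "adj_op T (J x) = J (adj_op T x)" for x
    by (rule qinner_eq_imp_eq) (simp add: qinner_adj_op_left[OF T] skew TJ)
  then show ?thesis by (simp add: fun_eq_iff TJ)
qed

theorem theorem3p23:
  fixes J T :: "'a::quaternionic_hilbert \<Rightarrow> 'a" and p :: real
  assumes "separable_space (euclidean :: 'a topology)"
    and "J \<in> bounded_ops" and "anti_selfadjoint J" and "unitary_op J"
    and "T \<in> compact_ops" and "commutator T J = (\<lambda>_. 0)"
    and "0 < p"
  shows "pow_op (abs_op T) p = pow_op (adj_op T \<circ> T) (p / 2)
    \<and> (T \<in> schatten_class J p \<longleftrightarrow> pow_op (abs_op T) p \<in> schatten_class J 1)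
    \<and> (pow_op (abs_op T) p \<in> schatten_class J 1 \<longleftrightarrow> adj_op T \<circ> T \<in> schatten_class J (p / 2))
    \<and> ennreal_powr (schatten_norm p T) p = ennreal_powr (schatten_norm p (abs_op T)) p
    \<and> ennreal_powr (schatten_norm p (abs_op T)) p = schatten_norm 1 (pow_op (abs_op T) p)
    \<and> schatten_norm 1 (pow_op (abs_op T) p) = ennreal_powr (schatten_norm (p / 2) (adj_op T \<circ> T)) (p / 2)
    \<and> (T \<in> schatten_class J p \<longleftrightarrow> abs_op T \<in> schatten_class J p)"
proof -
  define A where "A = adj_op T \<circ> T"
  define B where "B = pow_op (abs_op T) p"
  have T: "T \<in> bounded_ops" using assms(5) by (rule compact_opsD(1))
  have A_cpt: "A \<in> compact_ops"
    unfolding A_def by (rule comp_compact_ops[OF adj_op_bounded_ops[OF T] assms(5)])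
  then have A_bd: "A \<in> bounded_ops" by (rule compact_opsD(1))
  obtain E lam where A: "diagonalises E lam A"
    using positive_compact_diagonalises[OF A_cpt] positive_op_adj_op_comp[OF T]
    unfolding A_def by blast
  define a where "a e = sqrt (lam e)" for e
  note lam0 = diagonalisesD(3)[OF A]
  have abs: "diagonalises E a (abs_op T)" and abs_bd: "abs_op T \<in> bounded_ops"
    using sqrt_op_diagonalises[OF A A_bd] unfolding abs_op_def A_def[symmetric] a_def .
  have B: "diagonalises E (\<lambda>e. a e powr p) B" and B_bd: "B \<in> bounded_ops"
    using pow_op_diagonalises[OF abs abs_bd] assms(7) unfolding B_def by auto
  \<comment> \<open>Written as a power of \<open>a\<close>, the eigenvalues of \<open>A\<close> can
    be compared with those of \<open>abs_op T\<close>.\<close>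
  have A2: "diagonalises E (\<lambda>e. a e powr 2) A"
    by (rule diagonalises_cong[OF A]) (simp add: a_def lam0)
  have "diagonalises E (\<lambda>e. lam e powr (p / 2)) (pow_op A (p / 2))"
    using assms(7) by (intro pow_op_diagonalises(1)[OF A A_bd]) simp
  then have "diagonalises E (\<lambda>e. a e powr p) (pow_op A (p / 2))"
    by (rule diagonalises_cong) (simp add: a_def lam0 powr_half_sqrt[symmetric] powr_powr)
  then have pow: "B = pow_op A (p / 2)" by (rule diagonalises_unique[OF B])
  have fin: "finite {e \<in> E. r \<le> a e}" if "0 < r" for r
  proof -
    have "r\<^sup>2 \<le> lam e" if "e \<in> E" "r \<le> a e" for e
      using power_mono[OF that(2), of 2] \<open>0 < r\<close> lam0[OF that(1)] by (simp add: a_def)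
    then have "{e \<in> E. r \<le> a e} \<subseteq> {e \<in> E. r\<^sup>2 \<le> lam e}" by blast
    moreover have "finite {e \<in> E. r\<^sup>2 \<le> lam e}"
      using that by (intro diagonalises_compact_finite[OF A A_cpt]) simp
    ultimately show ?thesis by (rule finite_subset)
  qed
  have fin_powr: "finite {e \<in> E. r \<le> a e powr p}" if "0 < r" for r
  proof -
    have "{e \<in> E. r \<le> a e powr p} = {e \<in> E. r powr (1 / p) \<le> a e}"
      using le_powr_iff[OF that _ assms(7)] diagonalisesD(3)[OF abs] by auto
    then show ?thesis using fin that by simp
  qed
  have abs_cpt: "abs_op T \<in> compact_ops" by (rule diagonalises_finite_compact[OF abs abs_bd fin])
  have B_cpt: "B \<in> compact_ops" by (rule diagonalises_finite_compact[OF B B_bd fin_powr])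
  have comm: "A \<circ> J = J \<circ> A"
    unfolding A_def
    by (rule adj_op_comp_commute[OF T assms(2,3)]) (use assms(6) in \<open>simp add: commutator_eq_0_iff\<close>)
  have abs_comm: "abs_op T \<circ> J = J \<circ> abs_op T"
    by (rule diagonalises_map_commute[OF A abs[unfolded a_def] abs_bd assms(2) comm])
  have B_comm: "B \<circ> J = J \<circ> B"
    by (rule diagonalises_map_commute[OF abs B B_bd assms(2) abs_comm])
  note abs_abs = abs_op_of_diagonalises[OF abs abs_bd]
  have sv_abs: "singular_value (abs_op T) = singular_value T"
    by (simp only: singular_value_def abs_abs)
  have sv_B: "singular_value B n = singular_value T n powr p" for n
    using singular_value_powr[OF abs fin _ assms(7), of B] abs_op_of_diagonalises[OF B B_bd] B by simp
  have sv_A: "singular_value A n = singular_value T n powr 2" for n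
    using singular_value_powr[OF abs fin, of 2 A] abs_op_of_diagonalises[OF A A_bd] A2 by simp
  \<comment> \<open>Compactness and commutation hold for all four operators, so only summability
    remains, of the same sequence each time.\<close>
  have classes: "T \<in> schatten_class J p \<longleftrightarrow> summable (\<lambda>n. singular_value T n powr p)"
    "abs_op T \<in> schatten_class J p \<longleftrightarrow> summable (\<lambda>n. singular_value T n powr p)"
    "B \<in> schatten_class J 1 \<longleftrightarrow> summable (\<lambda>n. singular_value T n powr p)"
    "A \<in> schatten_class J (p / 2) \<longleftrightarrow> summable (\<lambda>n. singular_value T n powr p)"
    using assms(5,6) abs_cpt abs_comm B_cpt B_comm A_cpt comm
    by (simp_all add: schatten_class_def commutator_eq_0_iff sv_abs sv_B sv_A powr_powr)
  define X where "X = (\<Sum>n. ennreal (singular_value T n powr p))"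
  have norms: "ennreal_powr (schatten_norm p T) p = X"
    "ennreal_powr (schatten_norm p (abs_op T)) p = X"
    "schatten_norm 1 B = X"
    "ennreal_powr (schatten_norm (p / 2) A) (p / 2) = X"
  proof -
    show "ennreal_powr (schatten_norm p T) p = X" "ennreal_powr (schatten_norm p (abs_op T)) p = X"
      unfolding schatten_norm_def sv_abs X_def by (rule ennreal_powr_inverse_powr[OF assms(7)])+
    have "schatten_norm 1 B = ennreal_powr X 1"
      by (simp add: schatten_norm_def sv_B X_def)
    then show "schatten_norm 1 B = X" by (simp only: ennreal_powr_1)
    have sv: "singular_value A n powr (p / 2) = singular_value T n powr p" for n
      by (simp add: sv_A powr_powr)
    show "ennreal_powr (schatten_norm (p / 2) A) (p / 2) = X"
      unfolding schatten_norm_def X_def sv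
      by (rule ennreal_powr_inverse_powr) (use assms(7) in simp)
  qed
  show ?thesis
    unfolding A_def[symmetric] B_def[symmetric] classes norms using pow by blast
qed

end
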